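(* Let $\alpha,\beta>0$ with $\kappa_l=\beta/\alpha\ge1$. For any $\gamma\in(0,1]$, there exist a gossip matrix $W$ (an $n\times n$ matrix on some connected simple undirected graph $\mathcal{G}$ with $n\ge2$ nodes) of eigengap $\gamma(W)=\gamma$ and $\alpha$-strongly convex, $\beta$-smooth functions $f_i:\ell_2\to\mathbb{R}$, $i=1,\dots,n$, such that, with $\kappa_l=\beta/\alpha$, for any black-box procedure using $W$ (with communication time $\tau$) the time to reach a precision $\varepsilon>0$ is lower bounded by $$\Omega\left(\sqrt{\kappa_l}\left(1+\frac{\tau}{\sqrt\gamma}\right)\ln\left(\frac1\varepsilon\right)\right).$$
   Context: Notation: $g(\varepsilon)=\Omega(f(\varepsilon))$ means that there exists $C>0$ such that for all $\varepsilon>0$, $g(\varepsilon)\ge Cf(\varepsilon)$; in the bound of the claim, additive terms that do not depend on the precision $\varepsilon$ are, for simplicity, omitted. $\ell_2=\{\theta=(\theta_k)_{k\in\mathbb{N}}:\sum_k\theta_k^2<+\infty\}$. $f^*$ applied to a function denotes its Fenchel conjugate. A function is $\beta$-smooth if it is differentiable with $\beta$-Lipschitz gradient. Gossip matrix on $\mathcal{G}=(\mathcal{V},\mathcal{E})$, $\mathcal{V}=\{1,\dots,n\}$: an $n\times n$ real symmetric positive semi-definite matrix $W$ with $\mathrm{Ker}(W)=\mathrm{Span}(\mathbb{1})$, $\mathbb{1}=(1,\dots,1)^\top$, and $W_{ij}\neq0$ only if $i=j$ or $(i,j)\in\mathcal{E}$. With eigenvalues $\lambda_1(W)\ge\cdots\ge\lambda_n(W)=0$,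 its (normalized) eigengap is $\gamma(W)=\lambda_{n-1}(W)/\lambda_1(W)$. Black-box procedure: a distributed algorithm run on the nodes of $\mathcal{G}$, where node $i$ has access to $f_i$, a local computation takes time $1$, and a communication between neighbors takes time $\tau>0$ (which may be smaller or greater than $1$); computations and communications may be performed in parallel and asynchronously. It satisfies the following constraints. (1) Local memory: at each time $t\ge0$ node $i$ can store past values in a finite internal memory $\mathcal{M}_{i,t}\subset\ell_2$, with $\mathcal{M}_{i,0}=\{0\}$ and $\mathcal{M}_{i,t}\subset\mathcal{M}^{comp}_{i,t}\cup\mathcal{M}^{comm}_{i,t}$ for $t>0$. (2) Local computation: $\mathcal{M}^{comp}_{i,t}=\mathrm{Span}(\{\theta,\nabla f_i(\theta),\nabla f_i^*(\theta):\theta\in\mathcal{M}_{i,t-1}\})$. (3) Local communication: $\mathcal{M}^{comm}_{i,t}=\mathrm{Span}\big(\bigcup_{(i,j)\in\mathcal{E}}\mathcal{M}_{j,t-\tau}\big)$. The procedure uses the gossip matrix $W$ if the local communication is achieved by multiplication of a vector with $W$, i.e. the values obtained by node $i$ through communication at time $t$ are generated by the combinations $\sum_jW_{ij}\theta_j$ with $\theta_j\in\mathcal{M}_{j,t-\tau}$. (4) Output value: at each time $t$ node $i$ specifies a vector $\theta_{i,t}\in\mathcal{M}_{i,t}$ as its local output. Convention: memories at negative times are empty, and $\mathrm{Span}(\emptyset)=\{0\}$. Time to reach precision $\varepsilon$: the first time $t$ at which all local outputs satisfy $\bar f(\theta_{i,t})-\bar f(\theta^* )\le\varepsilon$, $i=1,\dots,n$,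 where $\bar f=\frac1n\sum_{i=1}^nf_i$ and $\theta^*$ is its minimizer (it is $+\infty$ if this never happens).
   Formalization: The case κ_l = 1 is excluded, as the claim is false there (all nodes reach the exact minimizer in finite time); for each κ_0 > 1 the constant in Ω is uniform over all κ_l ≥ κ_0, γ, τ, and the omitted additive term is explicit. *)

theory Defs
  imports
    "HOL-Analysis.Analysis"
    "HOL-Library.Extended_Real"
    "Jordan_Normal_Form.Char_Poly"
    "Jordan_Normal_Form.Matrix_Kernel"
begin

section \<open>The Hilbert space of square-summable real sequences\<close>

lemma summable_mult_of_summable_squares:
  fixes x y :: "nat \<Rightarrow> real"
  assumes "summable (\<lambda>k. (x k)\<^sup>2)" and "summable (\<lambda>k. (y k)\<^sup>2)"
  shows "summable (\<lambda>k. x k * y k)"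
proof (rule summable_comparison_test')
  show "summable (\<lambda>k. (x k)\<^sup>2 + (y k)\<^sup>2)"
    using assms by (rule summable_add)
next
  fix k :: nat
  have "2 * (\<bar>x k\<bar> * \<bar>y k\<bar>) \<le> (x k)\<^sup>2 + (y k)\<^sup>2"
    using sum_squares_bound[of "\<bar>x k\<bar>" "\<bar>y k\<bar>"] by simp
  moreover have "0 \<le> \<bar>x k\<bar> * \<bar>y k\<bar>" by simp
  ultimately show "norm (x k * y k) \<le> (x k)\<^sup>2 + (y k)\<^sup>2"
    unfolding real_norm_def abs_mult by linarith
qed

typedef ell2 = "{x :: nat \<Rightarrow> real. summable (\<lambda>k. (x k)\<^sup>2)}"
  morphisms ell2_nth Abs_ell2
  by (rule exI[of _ "\<lambda>_. 0"]) simp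

setup_lifting type_definition_ell2

instantiation ell2 :: real_inner
begin

lift_definition zero_ell2 :: ell2 is "\<lambda>_. 0" by simp

lift_definition plus_ell2 :: "ell2 \<Rightarrow> ell2 \<Rightarrow> ell2" is "\<lambda>x y k. x k + y k"
proof -
  fix x y :: "nat \<Rightarrow> real"
  assume s: "summable (\<lambda>k. (x k)\<^sup>2)" "summable (\<lambda>k. (y k)\<^sup>2)"
  have "summable (\<lambda>k. (x k)\<^sup>2 + (y k)\<^sup>2 + 2 * (x k * y k))"
    by (intro summable_add summable_mult summable_mult_of_summable_squares s)
  then show "summable (\<lambda>k. (x k + y k)\<^sup>2)"
    by (simp add: power2_sum algebra_simps)
qed

lift_definition uminus_ell2 :: "ell2 \<Rightarrow> ell2" is "\<lambda>x k. - x k" by simp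

definition minus_ell2 :: "ell2 \<Rightarrow> ell2 \<Rightarrow> ell2" where "minus_ell2 x y = x + - y"

lift_definition scaleR_ell2 :: "real \<Rightarrow> ell2 \<Rightarrow> ell2" is "\<lambda>c x k. c * x k"
  by (simp add: power_mult_distrib summable_mult)

lift_definition inner_ell2 :: "ell2 \<Rightarrow> ell2 \<Rightarrow> real" is "\<lambda>x y. \<Sum>k. x k * y k" .

definition norm_ell2 :: "ell2 \<Rightarrow> real" where "norm_ell2 x = sqrt (inner x x)"

definition dist_ell2 :: "ell2 \<Rightarrow> ell2 \<Rightarrow> real" where "dist_ell2 x y = norm (x - y)"

definition sgn_ell2 :: "ell2 \<Rightarrow> ell2" where "sgn_ell2 x = inverse (norm x) *\<^sub>R x"

definition uniformity_ell2 :: "(ell2 \<times> ell2) filter" where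
  "uniformity_ell2 = (INF e\<in>{0 <..}. principal {(x, y). dist x y < e})"

definition open_ell2 :: "ell2 set \<Rightarrow> bool" where
  "open_ell2 U \<longleftrightarrow> (\<forall>x\<in>U. \<forall>\<^sub>F (x', y) in uniformity. x' = x \<longrightarrow> y \<in> U)"

instance
proof
  fix x y z :: ell2 and a b :: real
  show "x + y + z = x + (y + z)" by transfer (simp add: add.assoc)
  show "x + y = y + x" by transfer (simp add: add.commute)
  show "0 + x = x" by transfer simp
  show "- x + x = 0" by transfer simp
  show "x - y = x + - y" by (rule minus_ell2_def)
  show "a *\<^sub>R (x + y) = a *\<^sub>R x + a *\<^sub>R y" by transfer (simp add: distrib_left)
  show "(a + b) *\<^sub>R x = a *\<^sub>R x + b *\<^sub>R x" by transfer (simp add: distrib_right)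
  show "a *\<^sub>R b *\<^sub>R x = (a * b) *\<^sub>R x" by transfer (simp add: mult.assoc)
  show "1 *\<^sub>R x = x" by transfer simp
  show "dist x y = norm (x - y)" by (rule dist_ell2_def)
  show "sgn x = inverse (norm x) *\<^sub>R x" by (rule sgn_ell2_def)
  show "uniformity = (INF e\<in>{0 <..}. principal {(x, y :: ell2). dist x y < e})"
    by (rule uniformity_ell2_def)
  fix U :: "ell2 set"
  show "open U \<longleftrightarrow> (\<forall>x\<in>U. \<forall>\<^sub>F (x', y) in uniformity. x' = x \<longrightarrow> y \<in> U)"
    by (rule open_ell2_def)
  show "inner x y = inner y x" by transfer (simp add: mult.commute)
  show "inner (x + y) z = inner x z + inner y z"
    by transfer (simp add: distrib_right suminf_add[symmetric] summable_mult_of_summable_squares)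
  show "inner (a *\<^sub>R x) y = a * inner x y"
    by transfer (simp add: mult.assoc suminf_mult summable_mult_of_summable_squares)
  show "0 \<le> inner x x"
    by transfer (simp add: suminf_nonneg flip: power2_eq_square)
  show "inner x x = 0 \<longleftrightarrow> x = 0"
    by transfer (simp add: suminf_eq_zero_iff fun_eq_iff flip: power2_eq_square)
  show "norm x = sqrt (inner x x)" by (rule norm_ell2_def)
qed

end


section \<open>Smooth and strongly convex functions\<close>

definition strongly_convex :: "real \<Rightarrow> ('a::real_inner \<Rightarrow> real) \<Rightarrow> bool" where
  "strongly_convex \<alpha> f \<longleftrightarrow> convex_on UNIV (\<lambda>x. f x - \<alpha> / 2 * (norm x)\<^sup>2)"

definition smooth :: "real \<Rightarrow> ('a::real_inner \<Rightarrow> real) \<Rightarrow> bool" where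
  "smooth \<beta> f \<longleftrightarrow> (\<exists>g. (\<forall>x. GDERIV f x :> g x) \<and> \<beta>-lipschitz_on UNIV g)"

definition grad :: "('a::real_inner \<Rightarrow> real) \<Rightarrow> 'a \<Rightarrow> 'a" where
  "grad f x = (THE D. GDERIV f x :> D)"

text \<open>
  The supremum is taken in the reals; it is only meaningful where it is finite. It is finite
  everywhere if \<open>f\<close> is smooth and \<open>\<alpha>\<close>-strongly convex with \<open>\<alpha> > 0\<close>.
\<close>

definition fenchel_conjugate :: "('a::real_inner \<Rightarrow> real) \<Rightarrow> 'a \<Rightarrow> real" where
  "fenchel_conjugate f y = (SUP x. inner x y - f x)"


section \<open>Graphs and gossip matrices\<close>

text \<open>
  Nodes and matrix indices are \<open>0, \<dots>, n - 1\<close>. An undirected edge is represented by both of its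
  orientations.
\<close>

definition connected_simple_graph :: "nat \<Rightarrow> (nat \<times> nat) set \<Rightarrow> bool" where
  "connected_simple_graph n E \<longleftrightarrow>
     E \<subseteq> {..<n} \<times> {..<n} \<and> sym E \<and> irrefl E \<and> (\<forall>i<n. \<forall>j<n. (i, j) \<in> E\<^sup>*)"

definition gossip_matrix :: "nat \<Rightarrow> (nat \<times> nat) set \<Rightarrow> real mat \<Rightarrow> bool" where
  "gossip_matrix n E W \<longleftrightarrow>
     W \<in> carrier_mat n n \<and>
     transpose_mat W = W \<and>
     (\<forall>v \<in> carrier_vec n. 0 \<le> scalar_prod v (W *\<^sub>v v)) \<and>
     mat_kernel W = range (\<lambda>c. c \<cdot>\<^sub>v vec n (\<lambda>_. 1)) \<and>
     (\<forall>i<n. \<forall>j<n. W $$ (i, j) \<noteq> 0 \<longrightarrow> i = j \<or> (i, j) \<in> E)"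

definition eigenvalues_desc :: "real mat \<Rightarrow> real list" where
  "eigenvalues_desc W = rev (sorted_list_of_multiset (proots (char_poly W)))"

text \<open>
  The list is indexed from \<open>0\<close>: with \<open>n = dim_row W\<close>, its entries \<open>n - 2\<close> and \<open>0\<close> are the
  eigenvalues usually written \<open>\<lambda>\<^sub>n\<^sub>-\<^sub>1\<close> and \<open>\<lambda>\<^sub>1\<close>.
\<close>

definition eigengap :: "real mat \<Rightarrow> real" where
  "eigengap W = eigenvalues_desc W ! (dim_row W - 2) / eigenvalues_desc W ! 0"


section \<open>Black-box procedures\<close>

text \<open>
  \<open>M i t\<close> is the memory of node \<open>i\<close> at time \<open>t\<close>; times are real numbers.
\<close>

definition comp_memory ::
  "(nat \<Rightarrow> 'a::real_inner \<Rightarrow> real) \<Rightarrow> (nat \<Rightarrow> real \<Rightarrow> 'a set) \<Rightarrow> nat \<Rightarrow> real \<Rightarrow> 'a set" where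
  "comp_memory f M i t =
     span (\<Union>\<theta> \<in> M i (t - 1). {\<theta>, grad (f i) \<theta>, grad (fenchel_conjugate (f i)) \<theta>})"

definition comm_memory ::
  "real mat \<Rightarrow> real \<Rightarrow> (nat \<Rightarrow> real \<Rightarrow> 'a::real_vector set) \<Rightarrow> nat \<Rightarrow> real \<Rightarrow> 'a set" where
  "comm_memory W \<tau> M i t =
     span {(\<Sum>j<dim_col W. W $$ (i, j) *\<^sub>R \<theta> j) | \<theta>. \<forall>j<dim_col W. \<theta> j \<in> M j (t - \<tau>)}"

text \<open>
  A procedure enters through its run on the functions \<open>f\<close>: the memories \<open>M\<close> and the local
  outputs \<open>out\<close>. Memories at negative times are empty and \<open>span {} = {0}\<close>, so nothing new can
  be computed before time \<open>1\<close> or received before time \<open>\<tau>\<close>.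
\<close>

definition black_box_procedure ::
  "nat \<Rightarrow> real mat \<Rightarrow> real \<Rightarrow> (nat \<Rightarrow> 'a::real_inner \<Rightarrow> real) \<Rightarrow>
   (nat \<Rightarrow> real \<Rightarrow> 'a set) \<Rightarrow> (nat \<Rightarrow> real \<Rightarrow> 'a) \<Rightarrow> bool" where
  "black_box_procedure n W \<tau> f M out \<longleftrightarrow>
     (\<forall>i<n.
        (\<forall>t<0. M i t = {}) \<and>
        M i 0 = {0} \<and>
        (\<forall>t\<ge>0. finite (M i t)) \<and>
        (\<forall>t>0. M i t \<subseteq> comp_memory f M i t \<union> comm_memory W \<tau> M i t) \<and>
        (\<forall>t\<ge>0. out i t \<in> M i t))"

definition avg_fun :: "nat \<Rightarrow> (nat \<Rightarrow> 'a \<Rightarrow> real) \<Rightarrow> 'a \<Rightarrow> real" where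
  "avg_fun n f \<theta> = (\<Sum>i<n. f i \<theta>) / real n"

text \<open>
  The infimum of the empty set is \<open>\<infinity>\<close>, the value when the precision is never reached.
\<close>

definition time_to_precision ::
  "nat \<Rightarrow> (nat \<Rightarrow> 'a \<Rightarrow> real) \<Rightarrow> (nat \<Rightarrow> real \<Rightarrow> 'a) \<Rightarrow> real \<Rightarrow> ereal" where
  "time_to_precision n f out \<epsilon> =
     Inf {ereal t | t. 0 \<le> t \<and>
       (\<forall>i<n. avg_fun n f (out i t) - avg_fun n f (arg_min (avg_fun n f) (\<lambda>_. True)) \<le> \<epsilon>)}"

end

theory Submission
  imports Defs
begin

text \<open>
  The hard instance is a quadratic chain in the coordinates of \<open>ell2\<close>. The nodes are arranged along a
  path. A group of nodes at one end couples the coordinates \<open>2 k\<close> and \<open>2 k + 1\<close>, a group at the other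
  end couples \<open>2 k + 1\<close> and \<open>2 k + 2\<close>, and each group contains about a third of all nodes. A vector
  supported on the first \<open>k\<close> coordinates can gain a new coordinate only at one of the two groups, and
  the group alternates with the parity of \<open>k\<close>. If the groups are \<open>d\<close> communication steps apart, each
  new coordinate therefore takes time at least \<open>1 + d \<tau>\<close>. This is \<open>black_box_time_to_leave\<close>, and it
  does not matter whether the nodes use gradients or gradients of Fenchel conjugates, because for
  quadratics made from an orthogonal projection both act through the same projection.
  
  The average function couples all consecutive coordinates, and its minimiser is the geometric
  sequence \<open>q ^ k\<close> (\<open>avg_fun_growth\<close>), where \<open>ln (1 / q)\<close> is of order \<open>1 / sqrt \<kappa>\<close>, with
  \<open>\<kappa> = \<beta> / \<alpha>\<close>, because a constant fraction of the nodes takes part in each coupling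
  (\<open>decay_rate_exists\<close>, \<open>decay_ratio_le\<close>). By strong convexity, a vector supported on the first \<open>k\<close>
  coordinates has an excess of at least \<open>\<alpha> / 2 * q ^ (2 * k)\<close>. So precision \<open>\<epsilon>\<close> needs about
  \<open>sqrt \<kappa> * ln (1 / \<epsilon>)\<close> coordinates, up to a constant factor, and time \<open>1 + d \<tau>\<close> for each of them.
  
  It remains to find a gossip matrix of eigengap exactly \<open>\<gamma>\<close> in which the two ends are of order
  \<open>1 / sqrt \<gamma>\<close> steps apart. The path on \<open>n\<close> nodes has an eigengap of order \<open>1 / n\<^sup>2\<close>, so \<open>n\<close> should be
  of order \<open>1 / sqrt \<gamma>\<close>. The exact value is then reached by a polynomial \<open>a L\<^sup>2 + b L\<close> in the Laplacian
  \<open>L\<close> of the path (\<open>path_polynomial_exists\<close>): it has the same eigenvectors, its two coefficients fix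
  the relevant eigenvalues, and it connects only nodes at distance at most two, which halves \<open>d\<close> and
  affects nothing but the constant.
\<close>

section \<open>Quadratics built from an orthogonal projection\<close>

lemma GDERIV_imp_grad_eq:
  assumes "GDERIV f x :> D"
  shows "grad f x = D"
  unfolding grad_def
proof (rule the_equality)
  show "GDERIV f x :> D" by (rule assms)
next
  fix D' assume "GDERIV f x :> D'"
  then have "(\<lambda>h. inner h D') = (\<lambda>h. inner h D)"
    using assms has_derivative_unique unfolding gderiv_def by blast
  then have "inner (D' - D) D' = inner (D' - D) D"
    by (rule fun_cong)
  then have "inner (D' - D) (D' - D) = 0"
    by (simp add: inner_diff_right)
  then show "D' = D" by simp
qed

definition projected_quadratic ::
    "('a::real_inner \<Rightarrow> 'a) \<Rightarrow> real \<Rightarrow> real \<Rightarrow> 'a \<Rightarrow> 'a \<Rightarrow> real" where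
  "projected_quadratic P \<alpha> \<beta> b x =
     \<alpha> / 2 * (norm x)\<^sup>2 + (\<beta> - \<alpha>) / 2 * (norm (P x))\<^sup>2 - inner b x"

text \<open>
  For an orthogonal projection \<open>P\<close> the Hessian \<open>\<alpha> I + (\<beta> - \<alpha>) P\<close> of \<open>projected_quadratic P \<alpha> \<beta> b\<close> has
  spectrum in \<open>{\<alpha>, \<beta>}\<close>, and its inverse \<open>I / \<alpha> + (1 / \<beta> - 1 / \<alpha>) P\<close> is again a combination of \<open>I\<close>
  and \<open>P\<close>. So the gradient of the function and the gradient of its Fenchel conjugate both give a
  node access to \<open>P\<close> and \<open>b\<close> only: the conjugate makes a procedure no stronger.
\<close>

locale orthogonal_projection =
  fixes P :: "'a::real_inner \<Rightarrow> 'a"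
  assumes linear: "linear P"
    and self_adjoint: "inner (P x) y = inner x (P y)"
    and idempotent: "P (P x) = P x"
begin

lemma inner_self_eq: "inner x (P x) = (norm (P x))\<^sup>2"
  by (metis idempotent power2_norm_eq_inner self_adjoint)

lemma norm_le: "norm (P x) \<le> norm x"
proof -
  have "norm (P x) * norm (P x) \<le> norm x * norm (P x)"
    using inner_self_eq[of x] norm_cauchy_schwarz[of x "P x"] by (simp add: power2_eq_square)
  then show ?thesis
    by (cases "norm (P x) = 0") (auto simp: mult_le_cancel_right)
qed

lemma bounded_linear: "bounded_linear P"
  using linear norm_le by (intro bounded_linear_intro[of _ 1]) (auto simp: linear_add linear_scale)

text \<open>
  The second-order expansion is exact. It yields the maximiser in the Fenchel conjugate and the
  growth of the average function around its minimiser.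
\<close>

lemma quadratic_expand:
  "projected_quadratic P \<alpha> \<beta> b y =
     projected_quadratic P \<alpha> \<beta> b x + inner (\<alpha> *\<^sub>R x + (\<beta> - \<alpha>) *\<^sub>R P x - b) (y - x)
     + \<alpha> / 2 * (norm (y - x))\<^sup>2 + (\<beta> - \<alpha>) / 2 * (norm (P (y - x)))\<^sup>2"
proof -
  define h where "h = y - x"
  have y: "y = x + h" by (simp add: h_def)
  have 1: "(norm (P (x + h)))\<^sup>2 = (norm (P x))\<^sup>2 + 2 * inner (P x) h + (norm (P h))\<^sup>2"
    unfolding linear_add[OF linear]
    by (simp add: power2_norm_eq_inner inner_add_left inner_add_right inner_commute[of "P h" "P x"])
       (metis idempotent self_adjoint)
  have 2: "(norm (x + h))\<^sup>2 = (norm x)\<^sup>2 + 2 * inner x h + (norm h)\<^sup>2"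
    by (simp add: power2_norm_eq_inner inner_add_left inner_add_right inner_commute)
  show ?thesis
    unfolding projected_quadratic_def h_def[symmetric] y 1 2
    by (simp add: inner_add_left inner_diff_left inner_add_right field_simps)
qed

lemma gderiv_quadratic:
  "GDERIV (projected_quadratic P \<alpha> \<beta> b) x :> \<alpha> *\<^sub>R x + (\<beta> - \<alpha>) *\<^sub>R P x - b"
proof -
  interpret bounded_linear P by (rule bounded_linear)
  have "projected_quadratic P \<alpha> \<beta> b = (\<lambda>x. \<alpha> / 2 * inner x x + (\<beta> - \<alpha>) / 2 * inner x (P x) - inner b x)"
    by (simp add: fun_eq_iff projected_quadratic_def inner_self_eq power2_norm_eq_inner)
  moreover have "inner x (P h) = inner h (P x)" for h
    by (metis inner_commute self_adjoint)
  moreover have "((\<lambda>x. \<alpha> / 2 * inner x x + (\<beta> - \<alpha>) / 2 * inner x (P x) - inner b x) has_derivative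
      (\<lambda>h. \<alpha> / 2 * (inner x h + inner h x) + (\<beta> - \<alpha>) / 2 * (inner x (P h) + inner h (P x)) - inner b h)) (at x)"
    by (auto intro!: derivative_eq_intros has_derivative)
  moreover have "\<alpha> / 2 * (inner x h + inner h x) + (\<beta> - \<alpha>) / 2 * (inner x (P h) + inner h (P x)) - inner b h
      = inner h (\<alpha> *\<^sub>R x + (\<beta> - \<alpha>) *\<^sub>R P x - b)" for h
    by (simp add: \<open>\<And>h. inner x (P h) = inner h (P x)\<close> inner_commute[of x h] inner_commute[of b h]
        inner_diff_right inner_add_right)
  ultimately show ?thesis
    unfolding gderiv_def by simp
qed

lemma strongly_convex_quadratic:
  assumes "\<alpha> \<le> \<beta>"
  shows "strongly_convex \<alpha> (projected_quadratic P \<alpha> \<beta> b)"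
  unfolding strongly_convex_def
proof (intro convex_onI)
  fix t :: real and x y :: 'a
  assume t: "0 < t" "t < 1"
  define F where "F = (\<lambda>x. projected_quadratic P \<alpha> \<beta> b x - \<alpha> / 2 * (norm x)\<^sup>2)"
  have F: "F x = (\<beta> - \<alpha>) / 2 * (norm (P x))\<^sup>2 - inner b x" for x
    by (simp add: F_def projected_quadratic_def)
  define u v where "u = P x" and "v = P y"
  have "(1 - t) * (norm u)\<^sup>2 + t * (norm v)\<^sup>2 - (norm ((1 - t) *\<^sub>R u + t *\<^sub>R v))\<^sup>2
     = t * (1 - t) * (norm (u - v))\<^sup>2"
    by (simp add: power2_norm_eq_inner inner_add_left inner_add_right inner_diff_left
        inner_diff_right inner_commute[of v u] algebra_simps)
  moreover have "0 \<le> t * (1 - t) * (norm (u - v))\<^sup>2" using t by simp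
  ultimately have "(norm ((1 - t) *\<^sub>R u + t *\<^sub>R v))\<^sup>2 \<le> (1 - t) * (norm u)\<^sup>2 + t * (norm v)\<^sup>2"
    by linarith
  then have "(\<beta> - \<alpha>) / 2 * (norm ((1 - t) *\<^sub>R u + t *\<^sub>R v))\<^sup>2
      \<le> (\<beta> - \<alpha>) / 2 * ((1 - t) * (norm u)\<^sup>2 + t * (norm v)\<^sup>2)"
    using assms by (intro mult_left_mono) auto
  moreover have "P ((1 - t) *\<^sub>R x + t *\<^sub>R y) = (1 - t) *\<^sub>R u + t *\<^sub>R v"
    by (simp add: u_def v_def linear_add[OF linear] linear_scale[OF linear])
  moreover have "inner b ((1 - t) *\<^sub>R x + t *\<^sub>R y) = (1 - t) * inner b x + t * inner b y"
    by (simp add: inner_add_right)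
  ultimately have "F ((1 - t) *\<^sub>R x + t *\<^sub>R y)
      \<le> (\<beta> - \<alpha>) / 2 * ((1 - t) * (norm u)\<^sup>2 + t * (norm v)\<^sup>2)
        - ((1 - t) * inner b x + t * inner b y)"
    unfolding F by simp
  also have "\<dots> = (1 - t) * F x + t * F y"
    unfolding F u_def v_def by (simp add: field_simps)
  finally have "F ((1 - t) *\<^sub>R x + t *\<^sub>R y) \<le> (1 - t) * F x + t * F y" .
  then show "projected_quadratic P \<alpha> \<beta> b ((1 - t) *\<^sub>R x + t *\<^sub>R y) - \<alpha> / 2 * (norm ((1 - t) *\<^sub>R x + t *\<^sub>R y))\<^sup>2
    \<le> (1 - t) * (projected_quadratic P \<alpha> \<beta> b x - \<alpha> / 2 * (norm x)\<^sup>2) + t * (projected_quadratic P \<alpha> \<beta> b y - \<alpha> / 2 * (norm y)\<^sup>2)"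
    by (simp add: F_def)
qed simp

lemma smooth_quadratic:
  assumes "0 \<le> \<alpha>" "\<alpha> \<le> \<beta>"
  shows "smooth \<beta> (projected_quadratic P \<alpha> \<beta> b)"
  unfolding smooth_def
proof (intro exI[of _ "\<lambda>x. \<alpha> *\<^sub>R x + (\<beta> - \<alpha>) *\<^sub>R P x - b"] conjI allI lipschitz_onI)
  fix x y :: 'a
  have "norm ((\<alpha> *\<^sub>R x + (\<beta> - \<alpha>) *\<^sub>R P x - b) - (\<alpha> *\<^sub>R y + (\<beta> - \<alpha>) *\<^sub>R P y - b))
      = norm (\<alpha> *\<^sub>R (x - y) + (\<beta> - \<alpha>) *\<^sub>R P (x - y))"
    by (simp add: linear_diff[OF linear] algebra_simps)
  also have "\<dots> \<le> \<alpha> * norm (x - y) + (\<beta> - \<alpha>) * norm (P (x - y))"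
    using assms by (intro order_trans[OF norm_triangle_ineq]) simp
  also have "\<dots> \<le> \<alpha> * norm (x - y) + (\<beta> - \<alpha>) * norm (x - y)"
    using assms norm_le by (intro add_mono mult_left_mono) auto
  finally show "dist (\<alpha> *\<^sub>R x + (\<beta> - \<alpha>) *\<^sub>R P x - b) (\<alpha> *\<^sub>R y + (\<beta> - \<alpha>) *\<^sub>R P y - b) \<le> \<beta> * dist x y"
    by (simp add: dist_norm algebra_simps)
qed (use assms gderiv_quadratic in auto)

lemma grad_quadratic: "grad (projected_quadratic P \<alpha> \<beta> b) x = \<alpha> *\<^sub>R x + (\<beta> - \<alpha>) *\<^sub>R P x - b"
  by (rule GDERIV_imp_grad_eq[OF gderiv_quadratic])

text \<open>
  The supremum is attained where the gradient equals \<open>y\<close>, that is at the image of \<open>y + b\<close> under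
  the inverse Hessian; the value there is half of the quadratic form of the inverse Hessian.
\<close>

lemma fenchel_conjugate_quadratic:
  assumes "0 < \<alpha>" "\<alpha> \<le> \<beta>"
  shows "fenchel_conjugate (projected_quadratic P \<alpha> \<beta> b) y = projected_quadratic P (1 / \<alpha>) (1 / \<beta>) 0 (y + b)"
proof -
  define z where "z = y + b"
  define w where "w = (1 / \<alpha>) *\<^sub>R z + (1 / \<beta> - 1 / \<alpha>) *\<^sub>R P z"
  have "P w = (1 / \<beta>) *\<^sub>R P z"
    by (simp add: w_def linear_add[OF linear] linear_scale[OF linear] idempotent
        flip: scaleR_add_left)
  then have "\<alpha> *\<^sub>R w + (\<beta> - \<alpha>) *\<^sub>R P w
      = (\<alpha> * (1 / \<alpha>)) *\<^sub>R z + (\<alpha> * (1 / \<beta> - 1 / \<alpha>) + (\<beta> - \<alpha>) * (1 / \<beta>)) *\<^sub>R P z"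
    by (simp add: w_def algebra_simps)
  also have "\<dots> = z"
  proof -
    have "\<alpha> * (1 / \<alpha>) = 1" "\<alpha> * (1 / \<beta> - 1 / \<alpha>) + (\<beta> - \<alpha>) * (1 / \<beta>) = 0"
      using assms by (auto simp: field_simps)
    then show ?thesis by (simp only: scaleR_one scaleR_zero_left add_0_right)
  qed
  finally have w: "\<alpha> *\<^sub>R w + (\<beta> - \<alpha>) *\<^sub>R P w - b = y"
    by (simp add: z_def)
  have val: "inner x y - projected_quadratic P \<alpha> \<beta> b x
      = (inner w y - projected_quadratic P \<alpha> \<beta> b w)
        - (\<alpha> / 2 * (norm (x - w))\<^sup>2 + (\<beta> - \<alpha>) / 2 * (norm (P (x - w)))\<^sup>2)" for x
    unfolding quadratic_expand[of \<alpha> \<beta> b x w] w by (simp add: inner_diff_right inner_commute[of y])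
  have "fenchel_conjugate (projected_quadratic P \<alpha> \<beta> b) y = inner w y - projected_quadratic P \<alpha> \<beta> b w"
    unfolding fenchel_conjugate_def
  proof (rule cSup_eq_maximum)
    show "inner w y - projected_quadratic P \<alpha> \<beta> b w \<in> range (\<lambda>x. inner x y - projected_quadratic P \<alpha> \<beta> b x)" by simp
  next
    fix s assume "s \<in> range (\<lambda>x. inner x y - projected_quadratic P \<alpha> \<beta> b x)"
    then obtain x where s: "s = inner x y - projected_quadratic P \<alpha> \<beta> b x" by blast
    have "0 \<le> \<alpha> / 2 * (norm (x - w))\<^sup>2 + (\<beta> - \<alpha>) / 2 * (norm (P (x - w)))\<^sup>2"
      using assms by (intro add_nonneg_nonneg mult_nonneg_nonneg) auto
    then show "s \<le> inner w y - projected_quadratic P \<alpha> \<beta> b w"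
      using val[of x] s by linarith
  qed
  also have "\<dots> = projected_quadratic P (1 / \<alpha>) (1 / \<beta>) 0 z"
  proof -
    have "inner z w = (1 / \<alpha>) * (norm z)\<^sup>2 + (1 / \<beta> - 1 / \<alpha>) * (norm (P z))\<^sup>2"
      by (simp add: w_def inner_add_right inner_self_eq power2_norm_eq_inner[of z])
    moreover have "inner z w = \<alpha> * (norm w)\<^sup>2 + (\<beta> - \<alpha>) * (norm (P w))\<^sup>2"
    proof -
      have "inner z w = inner (\<alpha> *\<^sub>R w + (\<beta> - \<alpha>) *\<^sub>R P w) w"
        using w by (simp add: z_def algebra_simps)
      then show ?thesis
        by (simp add: inner_add_left self_adjoint inner_self_eq power2_norm_eq_inner[of w])
    qed
    moreover have "inner z w = inner w y + inner b w"
      by (simp add: z_def inner_add_left inner_commute[of w])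
    moreover have "1 / \<alpha> / 2 * (norm z)\<^sup>2 = (1 / \<alpha>) * (norm z)\<^sup>2 / 2" by simp
    ultimately show ?thesis
      unfolding projected_quadratic_def by (simp only: inner_zero_left) (simp add: field_split_simps)
  qed
  finally show ?thesis by (simp add: z_def)
qed

lemma grad_fenchel_conjugate_quadratic:
  assumes "0 < \<alpha>" "\<alpha> \<le> \<beta>"
  shows "grad (fenchel_conjugate (projected_quadratic P \<alpha> \<beta> b)) y
    = (1 / \<alpha>) *\<^sub>R (y + b) + (1 / \<beta> - 1 / \<alpha>) *\<^sub>R P (y + b)"
proof (rule GDERIV_imp_grad_eq)
  have "((projected_quadratic P (1 / \<alpha>) (1 / \<beta>) 0 \<circ> (\<lambda>y. y + b)) has_derivative
     (\<lambda>h. inner h ((1 / \<alpha>) *\<^sub>R (y + b) + (1 / \<beta> - 1 / \<alpha>) *\<^sub>R P (y + b))) \<circ> (\<lambda>h. h)) (at y)"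
    using gderiv_quadratic[of "1 / \<alpha>" "1 / \<beta>" 0 "y + b"] unfolding gderiv_def
    by (intro diff_chain_at) (auto intro!: derivative_eq_intros)
  then show "GDERIV (fenchel_conjugate (projected_quadratic P \<alpha> \<beta> b)) y :>
      (1 / \<alpha>) *\<^sub>R (y + b) + (1 / \<beta> - 1 / \<alpha>) *\<^sub>R P (y + b)"
    unfolding gderiv_def fenchel_conjugate_quadratic[OF assms] comp_def .
qed

end

section \<open>Antisymmetric parts of square-summable sequences\<close>

lemma suminf_reindex_involution:
  fixes f :: "nat \<Rightarrow> real"
  assumes "summable (\<lambda>k. \<bar>f k\<bar>)" "\<And>k. \<sigma> (\<sigma> k) = k"
  shows "(\<lambda>k. f (\<sigma> k)) sums suminf f"
proof -
  have "bij \<sigma>" using assms(2) by (rule involuntory_imp_bij)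
  have "f summable_on UNIV"
    by (rule norm_summable_imp_summable_on) (use assms in simp)
  then obtain s where s: "(f has_sum s) UNIV" by (auto simp: summable_on_def)
  then have "((\<lambda>k. f (\<sigma> k)) has_sum s) UNIV"
    using has_sum_reindex_bij_betw[of \<sigma> UNIV UNIV f s] \<open>bij \<sigma>\<close> by simp
  then show ?thesis
    using s by (metis has_sum_imp_sums sums_unique)
qed

lemma summable_square_compose_involution:
  fixes x :: "nat \<Rightarrow> real"
  assumes "summable (\<lambda>k. (x k)\<^sup>2)" "\<And>k. \<sigma> (\<sigma> k) = k"
  shows "summable (\<lambda>k. (x (\<sigma> k))\<^sup>2)"
proof (rule sums_summable, rule suminf_reindex_involution[of "\<lambda>k. (x k)\<^sup>2" \<sigma>])
  show "summable (\<lambda>k. \<bar>(x k)\<^sup>2\<bar>)" using assms(1) by simp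
qed (rule assms(2))

definition permute :: "(nat \<Rightarrow> nat) \<Rightarrow> ell2 \<Rightarrow> ell2" where
  "permute \<sigma> x = Abs_ell2 (\<lambda>k. ell2_nth x (\<sigma> k))"

text \<open>
  The orthogonal projections of the hard instance. If \<open>\<sigma>\<close> is an involution of the coordinates that
  swaps some disjoint pairs, then \<open>antisym_part \<sigma>\<close> is the projection onto the span of the
  differences of the swapped unit vectors; for \<open>\<sigma> = id\<close> it is zero.
\<close>

definition antisym_part :: "(nat \<Rightarrow> nat) \<Rightarrow> ell2 \<Rightarrow> ell2" where
  "antisym_part \<sigma> x = (1 / 2) *\<^sub>R (x - permute \<sigma> x)"

lemma summable_ell2_nth: "summable (\<lambda>k. (ell2_nth x k)\<^sup>2)"
  using ell2_nth[of x] by simp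

lemma ell2_nth_permute:
  assumes "\<And>k. \<sigma> (\<sigma> k) = k"
  shows "ell2_nth (permute \<sigma> x) k = ell2_nth x (\<sigma> k)"
proof -
  have "(\<lambda>k. ell2_nth x (\<sigma> k)) \<in> {x. summable (\<lambda>k. (x k)\<^sup>2)}"
    using summable_square_compose_involution[of "ell2_nth x" \<sigma>, OF summable_ell2_nth assms]
    unfolding mem_Collect_eq .
  then show ?thesis unfolding permute_def by (simp only: Abs_ell2_inverse)
qed

lemma ell2_eqI: "(\<And>k. ell2_nth x k = ell2_nth y k) \<Longrightarrow> x = y"
  by (rule ell2_nth_inject[THEN iffD1], rule ext)

lemma ell2_nth_diff: "ell2_nth (x - y) k = ell2_nth x k - ell2_nth y k"
  by (simp only: minus_ell2_def plus_ell2.rep_eq uminus_ell2.rep_eq diff_conv_add_uminus)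

lemmas ell2_nth_simps =
  plus_ell2.rep_eq scaleR_ell2.rep_eq zero_ell2.rep_eq uminus_ell2.rep_eq ell2_nth_diff

lemma ell2_nth_antisym_part:
  assumes "\<And>k. \<sigma> (\<sigma> k) = k"
  shows "ell2_nth (antisym_part \<sigma> x) k = (ell2_nth x k - ell2_nth x (\<sigma> k)) / 2"
  by (simp add: antisym_part_def ell2_nth_simps ell2_nth_permute[of \<sigma>, OF assms])

lemma inner_permute:
  assumes "\<And>k. \<sigma> (\<sigma> k) = k"
  shows "inner (permute \<sigma> x) y = inner x (permute \<sigma> y)"
proof -
  define f where "f = (\<lambda>k. ell2_nth x k * ell2_nth y (\<sigma> k))"
  have "summable (\<lambda>k. \<bar>ell2_nth x k\<bar> * \<bar>ell2_nth y (\<sigma> k)\<bar>)"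
    using summable_ell2_nth[of x]
      summable_square_compose_involution[of "ell2_nth y" \<sigma>, OF summable_ell2_nth assms]
    by (intro summable_mult_of_summable_squares) (simp_all only: power2_abs)
  then have "(\<lambda>k. f (\<sigma> k)) sums suminf f"
    by (intro suminf_reindex_involution assms) (simp only: f_def abs_mult)
  then show ?thesis
    by (simp add: inner_ell2.rep_eq ell2_nth_permute[of \<sigma>, OF assms] f_def assms sums_iff)
qed

lemma orthogonal_projection_antisym_part:
  assumes "\<And>k. \<sigma> (\<sigma> k) = k"
  shows "orthogonal_projection (antisym_part \<sigma>)"
proof
  show "antisym_part \<sigma> (x + y) = antisym_part \<sigma> x + antisym_part \<sigma> y" for x y
    by (rule ell2_eqI)
       (simp add: ell2_nth_simps ell2_nth_antisym_part[of \<sigma>, OF assms] field_simps)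
  show "antisym_part \<sigma> (r *\<^sub>R x) = r *\<^sub>R antisym_part \<sigma> x" for r x
    by (rule ell2_eqI)
       (simp add: ell2_nth_simps ell2_nth_antisym_part[of \<sigma>, OF assms] field_simps)
  show "inner (antisym_part \<sigma> x) y = inner x (antisym_part \<sigma> y)" for x y
    by (simp add: antisym_part_def inner_diff_left inner_diff_right
        inner_permute[of \<sigma>, OF assms])
  show "antisym_part \<sigma> (antisym_part \<sigma> x) = antisym_part \<sigma> x" for x
    by (rule ell2_eqI)
       (simp add: ell2_nth_simps ell2_nth_antisym_part[of \<sigma>, OF assms] assms field_simps)
qed

lemma ell2_nth_square_le_norm: "(ell2_nth x k)\<^sup>2 \<le> (norm x)\<^sup>2"
proof -
  have "sum (\<lambda>k. (ell2_nth x k)\<^sup>2) {k} \<le> (\<Sum>k. (ell2_nth x k)\<^sup>2)"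
    by (rule sum_le_suminf[OF summable_ell2_nth]) auto
  moreover have "(norm x)\<^sup>2 = (\<Sum>k. (ell2_nth x k)\<^sup>2)"
    unfolding power2_norm_eq_inner inner_ell2.rep_eq by (simp only: power2_eq_square)
  ultimately show ?thesis by simp
qed

lift_definition first_unit :: ell2 is "\<lambda>k. if k = 0 then 1 else 0"
  by (rule summable_finite[of "{0}"]) auto

text \<open>
  The minimiser of the hard instance.
\<close>

definition geometric :: "real \<Rightarrow> ell2" where
  "geometric q = Abs_ell2 (\<lambda>k. q ^ k)"

lemma ell2_nth_geometric:
  assumes "0 < q" "q < 1"
  shows "ell2_nth (geometric q) k = q ^ k"
proof -
  have "q\<^sup>2 < 1" using assms by (simp add: power_less_one_iff)
  then have "summable (\<lambda>k. (q ^ k)\<^sup>2)"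
    using summable_geometric[of "q\<^sup>2"] assms by (simp add: mult.commute flip: power_mult)
  then show ?thesis by (simp add: geometric_def Abs_ell2_inverse)
qed

section \<open>The functions at the nodes\<close>

definition even_swap :: "nat \<Rightarrow> nat" where
  "even_swap j = (if even j then j + 1 else j - 1)"

definition odd_swap :: "nat \<Rightarrow> nat" where
  "odd_swap j = (if j = 0 then 0 else if odd j then j + 1 else j - 1)"

text \<open>
  The first \<open>m\<close> nodes couple the coordinates \<open>2 k\<close> and \<open>2 k + 1\<close>, the last \<open>m\<close> nodes the
  coordinates \<open>2 k + 1\<close> and \<open>2 k + 2\<close>, and the nodes between them couple nothing. Neither group can
  carry information along the sequence of coordinates on its own.
\<close>

definition node_swap :: "nat \<Rightarrow> nat \<Rightarrow> nat \<Rightarrow> nat \<Rightarrow> nat" where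
  "node_swap n m i = (if i < m then even_swap else if n - m \<le> i then odd_swap else id)"

lemma even_swap_involution: "even_swap (even_swap j) = j"
  by (auto simp: even_swap_def)

lemma odd_swap_involution: "odd_swap (odd_swap j) = j"
  by (auto simp: odd_swap_def)

lemma node_swap_involution: "node_swap n m i (node_swap n m i j) = j"
  by (simp add: node_swap_def even_swap_involution odd_swap_involution)

text \<open>
  An even prefix of the coordinates is a union of swapped pairs. So the first group of nodes cannot
  leave an even prefix, and in the same way the last group cannot leave an odd one.
\<close>

lemma even_swap_ge: "even k \<Longrightarrow> k \<le> j \<Longrightarrow> k \<le> even_swap j"
  unfolding even_swap_def by presburger

lemma odd_swap_ge: "odd k \<Longrightarrow> k \<le> j \<Longrightarrow> k \<le> odd_swap j"
  unfolding odd_swap_def by presburger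

lemma node_swap_ge: "Suc k \<le> j \<Longrightarrow> k \<le> node_swap n m i j"
  by (auto simp: node_swap_def even_swap_def odd_swap_def)

definition prefix_space :: "nat \<Rightarrow> ell2 set" where
  "prefix_space k = {x. \<forall>j\<ge>k. ell2_nth x j = 0}"

lemma subspace_prefix_space: "Real_Vector_Spaces.subspace (prefix_space k)"
  by (auto simp: real_vector.subspace_def prefix_space_def ell2_nth_simps)

lemma prefix_space_mono: "k \<le> l \<Longrightarrow> prefix_space k \<subseteq> prefix_space l"
  by (auto simp: prefix_space_def)

lemma antisym_part_in_prefix_space:
  assumes "\<And>j. \<sigma> (\<sigma> j) = j" "\<And>j. l \<le> j \<Longrightarrow> k \<le> \<sigma> j" "k \<le> l" "x \<in> prefix_space k"
  shows "antisym_part \<sigma> x \<in> prefix_space l"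
proof -
  have "ell2_nth (antisym_part \<sigma> x) j = 0" if "l \<le> j" for j
  proof -
    have "ell2_nth x j = 0" "ell2_nth x (\<sigma> j) = 0"
      using assms(2)[OF that] assms(3,4) that by (auto simp: prefix_space_def)
    then show ?thesis
      by (simp add: ell2_nth_antisym_part[of \<sigma>, OF assms(1)])
  qed
  then show ?thesis by (simp add: prefix_space_def)
qed

text \<open>
  The linear term \<open>c *\<^sub>R first_unit\<close> lies in every nonempty prefix, so what a gradient does to the
  support of a vector depends on \<open>\<sigma>\<close> alone.
\<close>

lemma projected_quadratic_grads_in_prefix_space:
  fixes \<sigma> :: "nat \<Rightarrow> nat"
  assumes f_def: "f = projected_quadratic (antisym_part \<sigma>) \<alpha> \<beta> (c *\<^sub>R first_unit)"
  assumes "0 < \<alpha>" "\<alpha> \<le> \<beta>" "\<And>j. \<sigma> (\<sigma> j) = j" "\<And>j. l \<le> j \<Longrightarrow> k \<le> \<sigma> j" "1 \<le> k" "k \<le> l"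
    and x: "x \<in> prefix_space k"
  shows "grad f x \<in> prefix_space l" "grad (fenchel_conjugate f) x \<in> prefix_space l"
proof -
  interpret orthogonal_projection "antisym_part \<sigma>"
    by (rule orthogonal_projection_antisym_part) (rule assms)
  have b: "c *\<^sub>R first_unit \<in> prefix_space k"
    using \<open>1 \<le> k\<close> by (auto simp: prefix_space_def ell2_nth_simps first_unit.rep_eq)
  have xb: "x + c *\<^sub>R first_unit \<in> prefix_space k"
    by (intro real_vector.subspace_add subspace_prefix_space x b)
  have P: "antisym_part \<sigma> y \<in> prefix_space l" if "y \<in> prefix_space k" for y
    by (rule antisym_part_in_prefix_space[where k = k]) (use assms that in auto)
  have l: "y \<in> prefix_space l" if "y \<in> prefix_space k" for y
    using prefix_space_mono[OF \<open>k \<le> l\<close>] that by auto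
  note add = real_vector.subspace_add[OF subspace_prefix_space]
    and diff = real_vector.subspace_diff[OF subspace_prefix_space]
    and scale = real_vector.subspace_scale[OF subspace_prefix_space]
  show "grad f x \<in> prefix_space l"
    unfolding f_def grad_quadratic by (rule diff[OF add[OF scale[OF l[OF x]] scale[OF P[OF x]]] l[OF b]])
  show "grad (fenchel_conjugate f) x \<in> prefix_space l"
    unfolding f_def grad_fenchel_conjugate_quadratic[OF \<open>0 < \<alpha>\<close> \<open>\<alpha> \<le> \<beta>\<close>]
    by (rule add[OF scale[OF l[OF xb]] scale[OF P[OF xb]]])
qed

section \<open>How fast a black-box procedure explores the coordinates\<close>

lemma span_not_subset_subspaceE:
  assumes "x \<in> span S" "x \<notin> V" "Real_Vector_Spaces.subspace V"
  obtains y where "y \<in> S" "y \<notin> V"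
  using assms real_vector.span_minimal by blast

text \<open>
  Let \<open>V k\<close> be subspaces such that one computation leads from \<open>V k\<close> at most to \<open>V (Suc k)\<close>, and
  let \<open>h k i\<close> be a lower bound for the number of communication steps between node \<open>i\<close> and the nodes
  that can leave \<open>V k\<close> at all. The nodes that can leave \<open>V (Suc k)\<close> are at distance at least \<open>d\<close>
  from those that can leave \<open>V k\<close>. Hence each new level costs one computation and \<open>d\<close>
  communications, that is time \<open>1 + d * \<tau>\<close>, and bringing the result to node \<open>i\<close> costs another
  \<open>\<tau> * h k i\<close>.
  
  The proof traces a vector outside \<open>V k\<close> back to its origin: either to an earlier vector outside
  \<open>V k\<close> (at the same node, or at a neighbour where \<open>h\<close> is smaller by at most one), or to a
  computation at a node with \<open>h k i \<le> 0\<close> on a vector that was outside the previous level.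
\<close>

lemma black_box_time_to_leave:
  fixes V :: "nat \<Rightarrow> 'a::real_inner set" and h :: "nat \<Rightarrow> nat \<Rightarrow> real"
  assumes run: "black_box_procedure n W \<tau> f M out"
    and W: "W \<in> carrier_mat n n" and \<tau>: "0 < \<tau>"
    and V: "\<And>k. Real_Vector_Spaces.subspace (V k)"
    and step: "\<And>k i \<theta>. 1 \<le> k \<Longrightarrow> i < n \<Longrightarrow> \<theta> \<in> V k \<Longrightarrow>
        grad (f i) \<theta> \<in> V (Suc k) \<and> grad (fenchel_conjugate (f i)) \<theta> \<in> V (Suc k)"
    and closed: "\<And>k i \<theta>. 1 \<le> k \<Longrightarrow> i < n \<Longrightarrow> 0 < h k i \<Longrightarrow> \<theta> \<in> V k \<Longrightarrow>
        grad (f i) \<theta> \<in> V k \<and> grad (fenchel_conjugate (f i)) \<theta> \<in> V k"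
    and hop: "\<And>k i j. i < n \<Longrightarrow> j < n \<Longrightarrow> W $$ (i, j) \<noteq> 0 \<Longrightarrow> h k i \<le> h k j + 1"
    and far: "\<And>k i. 1 \<le> k \<Longrightarrow> i < n \<Longrightarrow> h (Suc k) i \<le> 0 \<Longrightarrow> d \<le> h k i"
    and x: "1 \<le> k" "i < n" "x \<in> M i t" "x \<notin> V k"
  shows "(real k - 1) * (1 + d * \<tau>) + \<tau> * h k i \<le> t"
proof -
  \<comment> \<open>Times are real numbers; each step back in time is at least \<open>\<delta>\<close>, so the induction is on the
    number of intervals of length \<open>\<delta>\<close>.\<close>
  define \<delta> where "\<delta> = min 1 \<tau>"
  have \<delta>: "0 < \<delta>" "\<delta> \<le> 1" "\<delta> \<le> \<tau>" using \<tau> by (auto simp: \<delta>_def)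
  have dim: "dim_col W = n" using W by simp
  have "(real k - 1) * (1 + d * \<tau>) + \<tau> * h k i \<le> t"
    if "t \<le> real N * \<delta>" "1 \<le> k" "i < n" "x \<in> M i t" "x \<notin> V k" for N t k i x
    using that
  proof (induction N arbitrary: t k i x)
    case 0
    have "M i t \<subseteq> {0}"
      using run 0 unfolding black_box_procedure_def by (cases "t = 0") auto
    then show ?case using 0 real_vector.subspace_0[OF V[of k]] by auto
  next
    case (Suc N)
    note i = \<open>i < n\<close> and k = \<open>1 \<le> k\<close>
    have "M i t \<subseteq> {0}" if "t \<le> 0"
      using run i that unfolding black_box_procedure_def by (cases "t = 0") auto
    with Suc.prems have "0 < t" using real_vector.subspace_0[OF V[of k]] by fastforce
    then have "x \<in> comp_memory f M i t \<or> x \<in> comm_memory W \<tau> M i t"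
      using run i \<open>x \<in> M i t\<close> unfolding black_box_procedure_def by blast
    then show ?case
    proof
      assume "x \<in> comp_memory f M i t"
      then obtain y \<theta> where \<theta>: "\<theta> \<in> M i (t - 1)" "y \<notin> V k"
        "y = \<theta> \<or> y = grad (f i) \<theta> \<or> y = grad (fenchel_conjugate (f i)) \<theta>"
        unfolding comp_memory_def using span_not_subset_subspaceE[OF _ \<open>x \<notin> V k\<close> V] by blast
      have t1: "t - 1 \<le> real N * \<delta>"
        using \<open>t \<le> real (Suc N) * \<delta>\<close> \<open>\<delta> \<le> 1\<close> by (simp add: algebra_simps)
      show ?thesis
      proof (cases "\<theta> \<in> V k")
        case False
        with Suc.IH[OF t1 k i \<theta>(1)] show ?thesis by linarith
      next
        case True
        then have h: "h k i \<le> 0"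
          using closed[OF k i _ True] \<theta> by fastforce
        then have h': "\<tau> * h k i \<le> 0" using \<tau> by (simp add: mult_le_0_iff)
        show ?thesis
        proof (cases "k = 1")
          case True
          then show ?thesis using h' \<open>0 < t\<close> by simp
        next
          case False
          then obtain l where l: "k = Suc l" "1 \<le> l" using k by (cases k) auto
          have "\<theta> \<notin> V l \<or> y = \<theta>" using step[OF l(2) i, of \<theta>] \<theta> l by auto
          with \<theta> True have "\<theta> \<notin> V l" by auto
          then have "(real l - 1) * (1 + d * \<tau>) + \<tau> * h l i \<le> t - 1"
            using Suc.IH[OF t1 l(2) i \<theta>(1)] by blast
          moreover have "\<tau> * d \<le> \<tau> * h l i"
            using far[OF l(2) i] h l(1) \<tau> by simp
          moreover have "(real k - 1) * (1 + d * \<tau>) = (real l - 1) * (1 + d * \<tau>) + 1 + \<tau> * d"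
            by (simp add: l algebra_simps)
          ultimately show ?thesis using h' by linarith
        qed
      qed
    next
      assume "x \<in> comm_memory W \<tau> M i t"
      then obtain y where
        "y \<in> {(\<Sum>j<n. W $$ (i, j) *\<^sub>R \<theta> j) | \<theta>. \<forall>j<n. \<theta> j \<in> M j (t - \<tau>)}" and "y \<notin> V k"
        unfolding comm_memory_def dim by (rule span_not_subset_subspaceE[OF _ \<open>x \<notin> V k\<close> V])
      then obtain \<theta> where \<theta>: "\<And>j. j < n \<Longrightarrow> \<theta> j \<in> M j (t - \<tau>)"
        and sum: "(\<Sum>j<n. W $$ (i, j) *\<^sub>R \<theta> j) \<notin> V k"
        by auto
      have "\<exists>j<n. W $$ (i, j) *\<^sub>R \<theta> j \<notin> V k"
      proof (rule ccontr)
        assume "\<not> ?thesis"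
        then have "(\<Sum>j<n. W $$ (i, j) *\<^sub>R \<theta> j) \<in> V k"
          by (intro real_vector.subspace_sum V) auto
        with sum show False by contradiction
      qed
      then obtain j where j: "j < n" "W $$ (i, j) *\<^sub>R \<theta> j \<notin> V k" by blast
      then have "\<theta> j \<notin> V k" "W $$ (i, j) \<noteq> 0"
        using real_vector.subspace_scale[OF V[of k]] real_vector.subspace_0[OF V[of k]] by auto
      moreover have "t - \<tau> \<le> real N * \<delta>"
        using \<open>t \<le> real (Suc N) * \<delta>\<close> \<open>\<delta> \<le> \<tau>\<close> by (simp add: algebra_simps)
      ultimately have "(real k - 1) * (1 + d * \<tau>) + \<tau> * h k j \<le> t - \<tau>"
        using Suc.IH k j \<theta> by blast
      moreover have "\<tau> * h k i \<le> \<tau> * (h k j + 1)"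
        using hop[OF i j(1) \<open>W $$ (i, j) \<noteq> 0\<close>] \<tau> by (intro mult_left_mono) auto
      ultimately show ?thesis by (simp add: algebra_simps)
    qed
  qed
  moreover obtain N where "t / \<delta> \<le> real N" using real_arch_simple by blast
  then have "t \<le> real N * \<delta>" using \<delta> by (simp add: pos_divide_le_eq)
  ultimately show ?thesis using x by blast
qed

section \<open>The minimiser of the average function\<close>

lemma ell2_nth_sum: "ell2_nth (\<Sum>i\<in>I. g i) k = (\<Sum>i\<in>I. ell2_nth (g i) k)"
  by (induction I rule: infinite_finite_induct) (auto simp: ell2_nth_simps)

lemma sum_node_swap:
  fixes g :: "(nat \<Rightarrow> nat) \<Rightarrow> real"
  assumes "2 * m \<le> n"
  shows "(\<Sum>i<n. g (node_swap n m i)) = real m * g even_swap + real m * g odd_swap + real (n - 2 * m) * g id"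
proof -
  have "(\<Sum>i<n. g (node_swap n m i)) = (\<Sum>i\<in>{..<m} \<union> ({m..<n-m} \<union> {n-m..<n}). g (node_swap n m i))"
    using assms by (intro sum.cong) auto
  also have "\<dots> = (\<Sum>i<m. g (node_swap n m i)) + ((\<Sum>i\<in>{m..<n-m}. g (node_swap n m i))
      + (\<Sum>i\<in>{n-m..<n}. g (node_swap n m i)))"
  proof -
    have "{..<m} \<inter> ({m..<n-m} \<union> {n-m..<n}) = {}" "{m..<n-m} \<inter> {n-m..<n} = {}"
      using assms by auto
    then show ?thesis by (simp add: sum.union_disjoint)
  qed
  also have "(\<Sum>i<m. g (node_swap n m i)) = (\<Sum>i<m. g even_swap)"
    by (intro sum.cong) (auto simp: node_swap_def)
  also have "(\<Sum>i\<in>{m..<n-m}. g (node_swap n m i)) = (\<Sum>i\<in>{m..<n-m}. g id)"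
    by (intro sum.cong) (auto simp: node_swap_def)
  also have "(\<Sum>i\<in>{n-m..<n}. g (node_swap n m i)) = (\<Sum>i\<in>{n-m..<n}. g odd_swap)"
    using assms by (intro sum.cong) (auto simp: node_swap_def)
  finally have "(\<Sum>i<n. g (node_swap n m i)) = (\<Sum>i<m. g even_swap)
      + ((\<Sum>i\<in>{m..<n-m}. g id) + (\<Sum>i\<in>{n-m..<n}. g odd_swap))" .
  moreover have "n - (n - m) = m" "n - m - m = n - 2 * m" using assms by auto
  ultimately show ?thesis
    by (simp only: sum_constant card_lessThan card_atLeastLessThan add.commute add.left_commute)
qed

text \<open>
  Averaged over the nodes, the two couplings add up to the coupling of all consecutive coordinates
  with weight \<open>(\<beta> - \<alpha>) * (m / n)\<close>, so the stationarity condition is a linear recurrence of order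
  two with constant coefficients. The equation assumed for \<open>q\<close> says that \<open>q\<close> is a root of its
  characteristic polynomial, and \<open>c\<close> is chosen such that the geometric sequence also satisfies the
  boundary condition at coordinate \<open>0\<close>. Strong convexity gives the quadratic growth.
\<close>

lemma avg_fun_growth:
  fixes \<alpha> \<beta> q :: real
  assumes c_def: "c = \<alpha> + (\<beta> - \<alpha>) * (real m / real n) * (1 - q) / 2"
  assumes "2 * m \<le> n" "0 < n" "0 \<le> \<alpha>" "\<alpha> \<le> \<beta>" "0 < q" "q < 1"
    and q: "(\<beta> - \<alpha>) * (real m / real n) * (1 - q)\<^sup>2 = 2 * \<alpha> * q"
    and f: "f = (\<lambda>i. projected_quadratic (antisym_part (node_swap n m i)) \<alpha> \<beta> (c *\<^sub>R first_unit))"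
  shows "avg_fun n f (geometric q) + \<alpha> / 2 * (norm (x - geometric q))\<^sup>2 \<le> avg_fun n f x"
proof -
  define z where "z = geometric q"
  define \<sigma> where "\<sigma> = node_swap n m"
  define b where "b = c *\<^sub>R first_unit"
  define G where "G = (\<lambda>i. \<alpha> *\<^sub>R z + (\<beta> - \<alpha>) *\<^sub>R antisym_part (\<sigma> i) z - b)"
  have inv: "\<sigma> i (\<sigma> i j) = j" for i j by (simp add: \<sigma>_def node_swap_involution)
  have z: "ell2_nth z k = q ^ k" for k
    by (simp add: z_def ell2_nth_geometric \<open>0 < q\<close> \<open>q < 1\<close>)
  have "(\<Sum>i<n. G i) = 0"
  proof (rule ell2_eqI)
    fix k
    define \<delta> where "\<delta> = (\<beta> - \<alpha>) * (real m / real n)"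
    have "ell2_nth (\<Sum>i<n. G i) k
        = (\<Sum>i<n. \<alpha> * q ^ k + (\<beta> - \<alpha>) * ((q ^ k - q ^ \<sigma> i k) / 2) - ell2_nth b k)"
      unfolding ell2_nth_sum G_def
      by (simp add: ell2_nth_simps ell2_nth_antisym_part[of "\<sigma> _", OF inv] z)
    also have "\<dots> = real m * (\<alpha> * q ^ k + (\<beta> - \<alpha>) * ((q ^ k - q ^ even_swap k) / 2) - ell2_nth b k)
       + real m * (\<alpha> * q ^ k + (\<beta> - \<alpha>) * ((q ^ k - q ^ odd_swap k) / 2) - ell2_nth b k)
       + real (n - 2 * m) * (\<alpha> * q ^ k + (\<beta> - \<alpha>) * ((q ^ k - q ^ id k) / 2) - ell2_nth b k)"
      unfolding \<sigma>_def
      by (rule sum_node_swap[OF \<open>2 * m \<le> n\<close>,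
          of "\<lambda>s. \<alpha> * q ^ k + (\<beta> - \<alpha>) * ((q ^ k - q ^ s k) / 2) - ell2_nth b k"])
    also have "\<dots> = real n * (\<alpha> * q ^ k - ell2_nth b k)
        + (\<beta> - \<alpha>) * real m * ((2 * q ^ k - (q ^ even_swap k + q ^ odd_swap k)) / 2)"
      using \<open>2 * m \<le> n\<close> by (simp add: of_nat_diff field_simps)
    also have "\<dots> = real n * (\<alpha> * q ^ k - ell2_nth b k
        + \<delta> * ((2 * q ^ k - (q ^ even_swap k + q ^ odd_swap k)) / 2))"
      using \<open>0 < n\<close> by (simp add: \<delta>_def field_simps)
    also have "\<alpha> * q ^ k - ell2_nth b k
        + \<delta> * ((2 * q ^ k - (q ^ even_swap k + q ^ odd_swap k)) / 2) = 0"
    proof (cases k)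
      case 0
      then show ?thesis
        by (simp add: b_def c_def ell2_nth_simps first_unit.rep_eq even_swap_def odd_swap_def
            \<delta>_def field_simps)
    next
      case (Suc j)
      have "q ^ even_swap k + q ^ odd_swap k = q ^ j + q ^ Suc (Suc j)"
        by (simp add: Suc even_swap_def odd_swap_def)
      moreover have "ell2_nth b k = 0"
        by (simp add: Suc b_def ell2_nth_simps first_unit.rep_eq)
      moreover have "q ^ j * (\<delta> * (1 - q)\<^sup>2) = q ^ j * (2 * \<alpha> * q)"
        using q by (simp add: \<delta>_def)
      ultimately show ?thesis
        by (simp add: Suc power2_eq_square field_simps)
    qed
    finally show "ell2_nth (\<Sum>i<n. G i) k = ell2_nth 0 k" by (simp add: ell2_nth_simps)
  qed
  have le: "f i z + inner (G i) (x - z) + \<alpha> / 2 * (norm (x - z))\<^sup>2 \<le> f i x" for i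
  proof -
    interpret orthogonal_projection "antisym_part (\<sigma> i)"
      by (rule orthogonal_projection_antisym_part) (rule inv)
    show ?thesis
      unfolding f \<sigma>_def[symmetric] b_def[symmetric] G_def quadratic_expand[of \<alpha> \<beta> b x z]
      using \<open>\<alpha> \<le> \<beta>\<close> by simp
  qed
  have "(\<Sum>i<n. f i z) + real n * (\<alpha> / 2 * (norm (x - z))\<^sup>2)
      = (\<Sum>i<n. f i z) + inner (\<Sum>i<n. G i) (x - z) + real n * (\<alpha> / 2 * (norm (x - z))\<^sup>2)"
    using \<open>(\<Sum>i<n. G i) = 0\<close> by simp
  also have "\<dots> = (\<Sum>i<n. f i z + inner (G i) (x - z) + \<alpha> / 2 * (norm (x - z))\<^sup>2)"
    by (simp add: sum.distrib inner_sum_left)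
  also have "\<dots> \<le> (\<Sum>i<n. f i x)"
    using le by (intro sum_mono) auto
  finally have "((\<Sum>i<n. f i z) + real n * (\<alpha> / 2 * (norm (x - z))\<^sup>2)) / real n \<le> (\<Sum>i<n. f i x) / real n"
    by (intro divide_right_mono) auto
  then show ?thesis
    using \<open>0 < n\<close> unfolding avg_fun_def z_def[symmetric] by (simp add: add_divide_distrib)
qed

lemma avg_fun_arg_min_le:
  assumes "\<And>x. avg_fun n f z \<le> avg_fun n f x"
  shows "avg_fun n f (arg_min (avg_fun n f) (\<lambda>_. True)) \<le> avg_fun n f z"
  by (rule arg_minI[of "\<lambda>_. True" z "avg_fun n f"])
    (simp_all only: assms simp_thms not_less)

section \<open>Gossip matrices with prescribed eigenvectors\<close>

text \<open>
  The vector \<open>u k\<close> has the entries \<open>u k j\<close> for \<open>j < n\<close>. A matrix with the orthonormal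
  eigenvectors \<open>u k\<close> and eigenvalues \<open>\<mu> k\<close> has all properties of a gossip matrix visible in \<open>\<mu>\<close> and
  \<open>u\<close>, except for its support, which has to be checked separately.
\<close>

locale orthonormal_system =
  fixes n :: nat and u :: "nat \<Rightarrow> nat \<Rightarrow> real"
  assumes orthonormal: "k < n \<Longrightarrow> l < n \<Longrightarrow> (\<Sum>j<n. u k j * u l j) = (if k = l then 1 else 0)"
begin

definition base_mat :: "real mat" where
  "base_mat = mat n n (\<lambda>(k, j). u k j)"

definition spectral_mat :: "(nat \<Rightarrow> real) \<Rightarrow> real mat" where
  "spectral_mat \<mu> = mat n n (\<lambda>(i, j). \<Sum>k<n. \<mu> k * u k i * u k j)"

lemma base_mat_inverse:
  "base_mat * transpose_mat base_mat = 1\<^sub>m n" "transpose_mat base_mat * base_mat = 1\<^sub>m n"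
proof -
  show 1: "base_mat * transpose_mat base_mat = 1\<^sub>m n"
    by (rule eq_matI)
       (auto simp: base_mat_def scalar_prod_def orthonormal atLeast0LessThan)
  show "transpose_mat base_mat * base_mat = 1\<^sub>m n"
    by (rule mat_mult_left_right_inverse[OF _ _ 1]) (auto simp: base_mat_def)
qed

lemma complete:
  assumes "i < n" "j < n"
  shows "(\<Sum>k<n. u k i * u k j) = (if i = j then 1 else 0)"
proof -
  have "(\<Sum>k<n. u k i * u k j) = (transpose_mat base_mat * base_mat) $$ (i, j)"
    using assms by (simp add: base_mat_def scalar_prod_def atLeast0LessThan)
  then show ?thesis using assms by (simp add: base_mat_inverse)
qed

lemma expand:
  assumes "j < n"
  shows "(\<Sum>k<n. u k j * (\<Sum>i<n. u k i * x i)) = x j"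
proof -
  have "(\<Sum>k<n. u k j * (\<Sum>i<n. u k i * x i)) = (\<Sum>i<n. (\<Sum>k<n. u k i * u k j) * x i)"
    unfolding sum_distrib_left sum_distrib_right
    by (subst sum.swap) (simp add: mult_ac)
  also have "\<dots> = (\<Sum>i<n. (if i = j then 1 else 0) * x i)"
    using assms complete by (intro sum.cong) auto
  also have "\<dots> = x j" using assms by (simp add: if_distrib[of "\<lambda>c. c * _"] cong: if_cong)
  finally show ?thesis .
qed

lemma spectral_mat_carrier: "spectral_mat \<mu> \<in> carrier_mat n n"
  by (simp add: spectral_mat_def)

text \<open>
  With the \<open>u k\<close> as rows of an orthogonal matrix \<open>U\<close> and the \<open>\<mu> k\<close> on the diagonal of \<open>D\<close>, the
  spectral matrix is \<open>U\<^sup>T D U\<close>, hence similar to \<open>D\<close>.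
\<close>

lemma proots_spectral_mat: "proots (char_poly (spectral_mat \<mu>)) = mset (map \<mu> [0..<n])"
proof -
  define D where "D = mat n n (\<lambda>(i, j). if i = j then \<mu> i else 0)"
  have U: "base_mat \<in> carrier_mat n n" and D: "D \<in> carrier_mat n n"
    by (auto simp: base_mat_def D_def)
  have DU: "D * base_mat = mat n n (\<lambda>(k, j). \<mu> k * u k j)"
  proof (rule eq_matI)
    fix k j assume "k < dim_row (mat n n (\<lambda>(k, j). \<mu> k * u k j))"
      "j < dim_col (mat n n (\<lambda>(k, j). \<mu> k * u k j))"
    then have kj: "k < n" "j < n" by auto
    then have "(D * base_mat) $$ (k, j) = (\<Sum>i\<in>{0..<n}. (if k = i then \<mu> k else 0) * u i j)"
      by (simp add: D_def base_mat_def scalar_prod_def)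
    also have "\<dots> = (\<Sum>i\<in>{0..<n}. if k = i then \<mu> k * u k j else 0)"
      by (intro sum.cong) auto
    also have "\<dots> = \<mu> k * u k j"
      using kj by simp
    finally show "(D * base_mat) $$ (k, j) = mat n n (\<lambda>(k, j). \<mu> k * u k j) $$ (k, j)"
      using kj by simp
  qed (auto simp: D_def base_mat_def)
  have "spectral_mat \<mu> = transpose_mat base_mat * (D * base_mat)"
    unfolding DU
    by (rule eq_matI)
       (auto simp: spectral_mat_def base_mat_def scalar_prod_def atLeast0LessThan mult_ac intro!: sum.cong)
  also have "\<dots> = transpose_mat base_mat * D * base_mat"
    by (rule assoc_mult_mat[symmetric, of _ n n _ n _ n]) (use U D in auto)
  finally have "similar_mat_wit (spectral_mat \<mu>) D (transpose_mat base_mat) base_mat"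
    using base_mat_inverse U D spectral_mat_carrier by (intro similar_mat_witI[where n = n]) auto
  then have "char_poly (spectral_mat \<mu>) = char_poly D"
    by (intro char_poly_similar) (auto simp: similar_mat_def)
  also have "\<dots> = (\<Prod>a\<leftarrow>diag_mat D. [:- a, 1:])"
    by (rule char_poly_upper_triangular[OF D]) (auto simp: D_def upper_triangular_def)
  also have "diag_mat D = map \<mu> [0..<n]"
    by (auto simp: diag_mat_def D_def)
  also have "proots (\<Prod>a\<leftarrow>xs. [:- a, 1:]) = mset xs" for xs :: "real list"
  proof (induction xs)
    case (Cons a xs)
    have "(\<Prod>a\<leftarrow>xs. [:- a, 1:]) \<noteq> 0"
      unfolding prod_list_zero_iff by auto
    then show ?case using Cons by (simp add: proots_mult del: mult_pCons_left)
  qed simp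
  finally show ?thesis .
qed

lemma spectral_mat_mult_vec:
  assumes "v \<in> carrier_vec n" "i < n"
  shows "vec_index (spectral_mat \<mu> *\<^sub>v v) i
    = (\<Sum>k<n. \<mu> k * u k i * (\<Sum>j<n. u k j * vec_index v j))"
proof -
  have "vec_index (spectral_mat \<mu> *\<^sub>v v) i = (\<Sum>j<n. (\<Sum>k<n. \<mu> k * u k i * u k j) * vec_index v j)"
    using assms by (simp add: spectral_mat_def scalar_prod_def atLeast0LessThan)
  also have "\<dots> = (\<Sum>k<n. \<mu> k * u k i * (\<Sum>j<n. u k j * vec_index v j))"
    unfolding sum_distrib_left sum_distrib_right
    by (subst sum.swap) (simp add: mult_ac)
  finally show ?thesis .
qed

lemma spectral_mat_quadratic_form:
  assumes v: "v \<in> carrier_vec n"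
  shows "scalar_prod v (spectral_mat \<mu> *\<^sub>v v) = (\<Sum>k<n. \<mu> k * (\<Sum>j<n. u k j * vec_index v j)\<^sup>2)"
proof -
  have "scalar_prod v (spectral_mat \<mu> *\<^sub>v v)
      = (\<Sum>i<n. vec_index v i * vec_index (spectral_mat \<mu> *\<^sub>v v) i)"
    using v by (simp add: scalar_prod_def spectral_mat_def atLeast0LessThan)
  also have "\<dots> = (\<Sum>i<n. vec_index v i * (\<Sum>k<n. \<mu> k * u k i * (\<Sum>j<n. u k j * vec_index v j)))"
    using spectral_mat_mult_vec[OF v] by (intro sum.cong) auto
  also have "\<dots> = (\<Sum>k<n. \<Sum>i<n. vec_index v i * (\<mu> k * u k i * (\<Sum>j<n. u k j * vec_index v j)))"
    unfolding sum_distrib_left[of "vec_index v _"] by (rule sum.swap)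
  also have "\<dots> = (\<Sum>k<n. \<mu> k * (\<Sum>j<n. u k j * vec_index v j)\<^sup>2)"
    unfolding power2_eq_square
    by (intro sum.cong refl) (simp add: sum_distrib_left sum_distrib_right mult_ac)
  finally show ?thesis .
qed

lemma gossip_matrix_spectral_mat:
  assumes "1 \<le> n" and const: "\<And>i. i < n \<Longrightarrow> u 0 i = c" and \<mu>0: "\<mu> 0 = 0"
    and pos: "\<And>k. 1 \<le> k \<Longrightarrow> k < n \<Longrightarrow> 0 < \<mu> k"
    and supp: "\<And>i j. i < n \<Longrightarrow> j < n \<Longrightarrow> i \<noteq> j \<Longrightarrow> (i, j) \<notin> E \<Longrightarrow> (\<Sum>k<n. \<mu> k * u k i * u k j) = 0"
  shows "gossip_matrix n E (spectral_mat \<mu>)"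
  unfolding gossip_matrix_def
proof (intro conjI ballI allI impI)
  have \<mu>: "0 \<le> \<mu> k" if "k < n" for k
    using pos[of k] \<mu>0 that by (cases "k = 0") auto
  show "spectral_mat \<mu> \<in> carrier_mat n n" by (rule spectral_mat_carrier)
  show "transpose_mat (spectral_mat \<mu>) = spectral_mat \<mu>"
    by (rule eq_matI) (auto simp: spectral_mat_def mult_ac)
  show "0 \<le> scalar_prod v (spectral_mat \<mu> *\<^sub>v v)" if "v \<in> carrier_vec n" for v
    unfolding spectral_mat_quadratic_form[OF that] using \<mu> by (intro sum_nonneg) auto
  show "i = j \<or> (i, j) \<in> E" if "i < n" "j < n" "spectral_mat \<mu> $$ (i, j) \<noteq> 0" for i j
    using supp[of i j] that by (auto simp: spectral_mat_def)
  show "mat_kernel (spectral_mat \<mu>) = range (\<lambda>c. c \<cdot>\<^sub>v vec n (\<lambda>_. 1))"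
  proof (intro equalityI subsetI)
    fix v assume "v \<in> mat_kernel (spectral_mat \<mu>)"
    then have v: "v \<in> carrier_vec n" and Wv: "spectral_mat \<mu> *\<^sub>v v = 0\<^sub>v n"
      by (auto simp: mat_kernel_def spectral_mat_def)
    define a where "a = (\<lambda>k. \<Sum>j<n. u k j * vec_index v j)"
    have "(\<Sum>k<n. \<mu> k * (a k)\<^sup>2) = 0"
      using spectral_mat_quadratic_form[OF v, of \<mu>] v unfolding Wv a_def by simp
    then have "\<forall>k\<in>{..<n}. \<mu> k * (a k)\<^sup>2 = 0"
      by (subst (asm) sum_nonneg_eq_0_iff) (use \<mu> in auto)
    then have a: "a k = 0" if "1 \<le> k" "k < n" for k
    proof -
      have "\<mu> k * (a k)\<^sup>2 = 0" using \<open>\<forall>k\<in>{..<n}. \<mu> k * (a k)\<^sup>2 = 0\<close> that by simp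
      then show ?thesis using pos[OF that] by simp
    qed
    have "vec_index v j = c * a 0" if "j < n" for j
    proof -
      have "vec_index v j = (\<Sum>k<n. u k j * a k)"
        using expand[OF that, of "vec_index v"] by (simp add: a_def)
      also have "\<dots> = (\<Sum>k\<in>{0}. u k j * a k)"
        using a \<open>1 \<le> n\<close> by (intro sum.mono_neutral_right) auto
      finally show ?thesis using const[OF that] by simp
    qed
    then have "v = (c * a 0) \<cdot>\<^sub>v vec n (\<lambda>_. 1)"
      using v by (intro eq_vecI) auto
    then show "v \<in> range (\<lambda>c. c \<cdot>\<^sub>v vec n (\<lambda>_. 1))" by blast
  next
    fix v :: "real vec" assume "v \<in> range (\<lambda>c. c \<cdot>\<^sub>v vec n (\<lambda>_. 1))"
    then obtain s where s: "v = s \<cdot>\<^sub>v vec n (\<lambda>_. 1)" by blast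
    then have v: "v \<in> carrier_vec n" by simp
    have "c \<noteq> 0"
      using orthonormal[of 0 0] const \<open>1 \<le> n\<close> by auto
    have *: "\<mu> k * (\<Sum>j<n. u k j * vec_index v j) = 0" if "k < n" for k
    proof (cases "k = 0")
      case False
      have "(\<Sum>j<n. u k j * c) = (\<Sum>j<n. u k j * u 0 j)"
        using const by (intro sum.cong) auto
      also have "\<dots> = 0" using orthonormal[of k 0] that False by auto
      finally have "(\<Sum>j<n. u k j) = 0"
        using \<open>c \<noteq> 0\<close> by (simp flip: sum_distrib_right)
      then have "(\<Sum>j<n. u k j * vec_index v j) = 0"
        by (simp add: s flip: sum_distrib_right)
      then show ?thesis by simp
    qed (simp add: \<mu>0)
    have "spectral_mat \<mu> *\<^sub>v v = 0\<^sub>v n"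
    proof (rule eq_vecI)
      fix i assume "i < dim_vec (0\<^sub>v n :: real vec)"
      then have i: "i < n" by simp
      have "vec_index (spectral_mat \<mu> *\<^sub>v v) i
        = (\<Sum>k<n. u k i * (\<mu> k * (\<Sum>j<n. u k j * vec_index v j)))"
        unfolding spectral_mat_mult_vec[OF v i] by (simp add: mult_ac)
      also have "\<dots> = 0" using * by (intro sum.neutral) auto
      finally show "vec_index (spectral_mat \<mu> *\<^sub>v v) i = vec_index (0\<^sub>v n) i" using i by simp
    qed (simp add: spectral_mat_def)
    then show "v \<in> mat_kernel (spectral_mat \<mu>)"
      using v by (auto simp: mat_kernel_def spectral_mat_def)
  qed
qed

text \<open>
  The values \<open>\<mu> k\<close> need not be sorted: it suffices that \<open>\<mu> 0\<close>, \<open>\<mu> 1\<close> and \<open>\<mu> (n - 1)\<close> are the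
  smallest, a second smallest and a largest eigenvalue.
\<close>

lemma eigengap_spectral_mat:
  assumes "2 \<le> n" "\<mu> 0 \<le> \<mu> 1"
    and between: "\<And>k. 1 \<le> k \<Longrightarrow> k < n \<Longrightarrow> \<mu> 1 \<le> \<mu> k \<and> \<mu> k \<le> \<mu> (n - 1)"
  shows "eigengap (spectral_mat \<mu>) = \<mu> 1 / \<mu> (n - 1)"
proof -
  define xs where "xs = sort (map \<mu> [0..<n])"
  have ed: "eigenvalues_desc (spectral_mat \<mu>) = rev xs"
    by (simp only: eigenvalues_desc_def proots_spectral_mat sorted_list_of_multiset_mset xs_def)
  have len: "length xs = n" and sorted: "sorted xs" and set: "set xs = \<mu> ` {..<n}"
    by (auto simp: xs_def)
  have up: "[0..<n] = 0 # 1 # [2..<n]"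
    using assms(1) by (simp add: upt_conv_Cons numeral_2_eq_2)
  have "xs = \<mu> 0 # \<mu> 1 # sort (map \<mu> [2..<n])"
  proof -
    have 1: "insort (\<mu> 1) (sort (map \<mu> [2..<n])) = \<mu> 1 # sort (map \<mu> [2..<n])"
      using between by (intro insort_is_Cons) auto
    have "xs = insort (\<mu> 0) (insort (\<mu> 1) (sort (map \<mu> [2..<n])))"
      unfolding xs_def up by simp
    also have "\<dots> = insort (\<mu> 0) (\<mu> 1 # sort (map \<mu> [2..<n]))" by (simp only: 1)
    also have "\<dots> = \<mu> 0 # \<mu> 1 # sort (map \<mu> [2..<n])"
      using assms(2) by simp
    finally show ?thesis .
  qed
  then have "xs ! 1 = \<mu> 1" by simp
  moreover have "rev xs ! (n - 2) = xs ! 1"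
    using assms(1) len by (simp add: rev_nth Suc_diff_Suc)
  moreover have "rev xs ! 0 = xs ! (n - 1)"
    using assms(1) len by (simp add: rev_nth)
  moreover have "xs ! (n - 1) = \<mu> (n - 1)"
  proof (rule antisym)
    have "xs ! (n - 1) \<in> \<mu> ` {..<n}"
      using assms(1) len set nth_mem[of "n - 1" xs] by simp
    then obtain k where k: "xs ! (n - 1) = \<mu> k" "k < n" by auto
    show "xs ! (n - 1) \<le> \<mu> (n - 1)"
      using k between[of k] between[of 1] assms(1,2) by (cases "k = 0") auto
    have "\<mu> (n - 1) \<in> set xs" using set assms(1) by auto
    then obtain i where "i < n" "xs ! i = \<mu> (n - 1)" by (metis in_set_conv_nth len)
    then show "\<mu> (n - 1) \<le> xs ! (n - 1)"
      using sorted_nth_mono[OF sorted, of i "n - 1"] len by simp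
  qed
  moreover have "dim_row (spectral_mat \<mu>) = n" by (simp add: spectral_mat_def)
  ultimately show ?thesis by (simp only: eigengap_def ed)
qed

end

section \<open>The spectrum of the path\<close>

text \<open>
  The Laplacian of the path on \<open>n\<close> nodes has the eigenvalues \<open>path_ev n k\<close> with eigenvectors
  \<open>path_cos n k\<close>. Its action on a vector \<open>x\<close> is written
  \<open>2 * x j - x (j - 1) - x (path_succ n j)\<close>: truncated subtraction at \<open>0\<close> and \<open>path_succ\<close> at \<open>n - 1\<close>
  repeat the boundary value, which gives the end nodes degree one.
\<close>

definition path_ev :: "nat \<Rightarrow> nat \<Rightarrow> real" where
  "path_ev n k = 2 - 2 * cos (pi * real k / real n)"

definition path_cos :: "nat \<Rightarrow> nat \<Rightarrow> nat \<Rightarrow> real" where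
  "path_cos n k j = cos (pi * real k * (2 * real j + 1) / (2 * real n))"

definition path_vec :: "nat \<Rightarrow> nat \<Rightarrow> nat \<Rightarrow> real" where
  "path_vec n k j = path_cos n k j / sqrt (\<Sum>i<n. (path_cos n k i)\<^sup>2)"

definition path_succ :: "nat \<Rightarrow> nat \<Rightarrow> nat" where
  "path_succ n j = (if Suc j < n then Suc j else j)"

text \<open>
  The cosines are symmetric about the points \<open>-1/2\<close> and \<open>n - 1/2\<close>, so repeating the boundary value
  continues them beyond both ends of the path. Thus one addition formula serves all nodes.
\<close>

lemma path_cos_eigen:
  assumes "j < n"
  shows "2 * path_cos n k j - path_cos n k (j - 1) - path_cos n k (path_succ n j) = path_ev n k * path_cos n k j"
proof -
  define t where "t = pi * real k / (2 * real n)"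
  have c: "path_cos n k i = cos (t * (2 * real i + 1))" for i
    by (simp add: path_cos_def t_def)
  have ev: "path_ev n k = 2 - 2 * cos (2 * t)"
    using assms by (simp add: path_ev_def t_def)
  have left: "path_cos n k (j - 1) = cos (t * (2 * real j + 1) - 2 * t)"
  proof (cases "j = 0")
    case True
    then have "t * (2 * real j + 1) - 2 * t = - (t * (2 * real (j - 1) + 1))" by (simp add: algebra_simps)
    then show ?thesis by (simp only: c cos_minus)
  next
    case False
    then show ?thesis by (simp add: c of_nat_diff algebra_simps)
  qed
  have right: "path_cos n k (path_succ n j) = cos (t * (2 * real j + 1) + 2 * t)"
  proof (cases "Suc j < n")
    case True
    then show ?thesis by (simp add: c path_succ_def algebra_simps)
  next
    case False
    with assms have n: "n = Suc j" by simp
    have "t * (2 * real n) = pi * real k" using assms by (simp add: t_def)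
    then have e: "t * (2 * real j + 1) + 2 * t = pi * real k + t"
      "t * (2 * real j + 1) = pi * real k - t"
      by (simp_all add: n algebra_simps)
    have "sin (pi * real k) = 0" using sin_npi2 by simp
    then show ?thesis
      unfolding path_succ_def c using False by (simp add: e cos_add cos_diff)
  qed
  have "cos (x - y) + cos (x + y) = 2 * cos y * cos x" for x y :: real
    by (simp add: cos_add cos_diff)
  from this[of "t * (2 * real j + 1)" "2 * t"] show ?thesis
    unfolding left right ev unfolding c by (simp add: algebra_simps)
qed

lemma path_laplacian_symmetric:
  fixes x y :: "nat \<Rightarrow> real"
  shows "(\<Sum>j<n. (2 * x j - x (j - 1) - x (path_succ n j)) * y j)
       = (\<Sum>j<n. x j * (2 * y j - y (j - 1) - y (path_succ n j)))"
proof (cases n)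
  case (Suc N)
  have left: "(\<Sum>j<n. x (j - 1) * y j) = x 0 * y 0 + (\<Sum>j<N. x j * y (Suc j))" for x y :: "nat \<Rightarrow> real"
    unfolding Suc by (subst sum.lessThan_Suc_shift) simp
  have right: "(\<Sum>j<n. x (path_succ n j) * y j) = (\<Sum>j<N. x (Suc j) * y j) + x N * y N" for x y :: "nat \<Rightarrow> real"
    unfolding Suc by (simp add: path_succ_def)
  have "(\<Sum>j<n. (2 * x j - x (j - 1) - x (path_succ n j)) * y j)
      = (\<Sum>j<n. 2 * (x j * y j)) - (\<Sum>j<n. x (j - 1) * y j) - (\<Sum>j<n. x (path_succ n j) * y j)"
    by (simp add: sum_subtractf[symmetric] algebra_simps)
  moreover have "(\<Sum>j<n. x j * (2 * y j - y (j - 1) - y (path_succ n j)))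
      = (\<Sum>j<n. 2 * (x j * y j)) - (\<Sum>j<n. y (j - 1) * x j) - (\<Sum>j<n. y (path_succ n j) * x j)"
    by (simp add: sum_subtractf[symmetric] algebra_simps)
  ultimately show ?thesis
    unfolding left right by (simp add: mult.commute)
qed simp

lemma path_ev_strict_mono:
  assumes "k < l" "l < n"
  shows "path_ev n k < path_ev n l"
proof -
  have "real l / real n \<le> 1" using assms by simp
  then have "pi * real l / real n \<le> pi"
    using mult_left_mono[of "real l / real n" 1 pi] by simp
  moreover have "pi * real k / real n < pi * real l / real n"
    using assms by (intro divide_strict_right_mono mult_strict_left_mono) auto
  ultimately have "cos (pi * real l / real n) < cos (pi * real k / real n)"
    by (intro cos_monotone_0_pi) auto
  then show ?thesis by (simp add: path_ev_def)
qed

lemma path_ev_0: "path_ev n 0 = 0"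
  by (simp add: path_ev_def)

text \<open>
  Eigenvectors of a symmetric operator for distinct eigenvalues.
\<close>

lemma path_cos_orthogonal:
  assumes "k < n" "l < n" "k \<noteq> l"
  shows "(\<Sum>j<n. path_cos n k j * path_cos n l j) = 0"
proof -
  have "path_ev n k * (\<Sum>j<n. path_cos n k j * path_cos n l j)
      = (\<Sum>j<n. (2 * path_cos n k j - path_cos n k (j - 1) - path_cos n k (path_succ n j)) * path_cos n l j)"
    unfolding sum_distrib_left by (intro sum.cong) (auto simp: path_cos_eigen simp del: One_nat_def)
  also have "\<dots> = (\<Sum>j<n. path_cos n k j * (2 * path_cos n l j - path_cos n l (j - 1) - path_cos n l (path_succ n j)))"
    by (rule path_laplacian_symmetric)
  also have "\<dots> = path_ev n l * (\<Sum>j<n. path_cos n k j * path_cos n l j)"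
    unfolding sum_distrib_left by (intro sum.cong) (auto simp: path_cos_eigen simp del: One_nat_def)
  finally have "(path_ev n k - path_ev n l) * (\<Sum>j<n. path_cos n k j * path_cos n l j) = 0"
    by (simp add: algebra_simps)
  moreover have "path_ev n k \<noteq> path_ev n l"
    using assms path_ev_strict_mono[of k l n] path_ev_strict_mono[of l k n] by (cases "k < l") auto
  ultimately show ?thesis by simp
qed

lemma path_cos_norm_pos:
  assumes "k < n"
  shows "0 < (\<Sum>i<n. (path_cos n k i)\<^sup>2)"
proof -
  have "pi * real k / (2 * real n) < pi / 2"
    using assms by (simp add: field_simps)
  then have "0 < path_cos n k 0"
    unfolding path_cos_def by (intro cos_gt_zero_pi) (auto intro: less_le_trans[of _ 0])
  then have "0 < (path_cos n k 0)\<^sup>2" by simp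
  also have "\<dots> = (\<Sum>i\<in>{0}. (path_cos n k i)\<^sup>2)" by simp
  also have "\<dots> \<le> (\<Sum>i<n. (path_cos n k i)\<^sup>2)"
    using assms by (intro sum_mono2) auto
  finally show ?thesis .
qed

lemma orthonormal_system_path_vec: "orthonormal_system n (path_vec n)"
proof
  fix k l assume kl: "k < n" "l < n"
  have "(\<Sum>j<n. path_vec n k j * path_vec n l j) = (\<Sum>j<n. path_cos n k j * path_cos n l j)
      / (sqrt (\<Sum>i<n. (path_cos n k i)\<^sup>2) * sqrt (\<Sum>i<n. (path_cos n l i)\<^sup>2))"
    by (simp add: path_vec_def sum_divide_distrib)
  also have "\<dots> = (if k = l then 1 else 0)"
    using path_cos_orthogonal[OF kl] path_cos_norm_pos[OF kl(1)]
    by (auto simp flip: power2_eq_square)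
  finally show "(\<Sum>j<n. path_vec n k j * path_vec n l j) = (if k = l then 1 else 0)" .
qed

lemma path_vec_eigen:
  assumes "j < n"
  shows "path_ev n k * path_vec n k j = 2 * path_vec n k j - path_vec n k (j - 1) - path_vec n k (path_succ n j)"
  unfolding path_vec_def times_divide_eq_right path_cos_eigen[OF assms, symmetric]
  by (simp add: diff_divide_distrib)

text \<open>
  A quadratic polynomial of the path Laplacian connects only nodes at distance at most two. In terms
  of the eigenvectors, each factor \<open>path_ev n k\<close> is absorbed by one of \<open>path_vec n k i\<close> and
  \<open>path_vec n k j\<close>, moving \<open>i\<close> or \<open>j\<close> by at most one, and completeness kills the sum of products at
  different nodes.
\<close>

lemma path_polynomial_local:
  fixes a b :: real
  assumes "i < n" "j < n" "i + 2 < j \<or> j + 2 < i"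
  shows "(\<Sum>k<n. (a * (path_ev n k)\<^sup>2 + b * path_ev n k) * path_vec n k i * path_vec n k j) = 0"
proof -
  interpret orthonormal_system n "path_vec n" by (rule orthonormal_system_path_vec)
  define s where "s = path_succ n"
  have s: "s i < n" "s j < n" "s i \<le> Suc i" "i \<le> s i" "s j \<le> Suc j" "j \<le> s j"
    using assms by (auto simp: s_def path_succ_def)
  have c: "(\<Sum>k<n. path_vec n k p * path_vec n k q) = 0"
    if "p < n" "q < n" "p \<noteq> q" for p q using complete[OF that(1,2)] that(3) by simp
  define r where "r = (\<lambda>k. 2 * path_vec n k i - path_vec n k (i - 1) - path_vec n k (s i))"
  have r: "path_ev n k * path_vec n k i = r k" for k
    unfolding path_vec_eigen[OF assms(1)] s_def r_def ..
  have t: "(\<Sum>k<n. r k * path_vec n k q) = 0" if "q < n" "i + 1 < q \<or> q + 1 < i" for q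
  proof -
    have "(\<Sum>k<n. r k * path_vec n k q)
      = 2 * (\<Sum>k<n. path_vec n k i * path_vec n k q) - (\<Sum>k<n. path_vec n k (i - 1) * path_vec n k q)
        - (\<Sum>k<n. path_vec n k (s i) * path_vec n k q)"
      by (simp add: r_def sum_subtractf[symmetric] sum_distrib_left algebra_simps)
    also have "\<dots> = 0"
      using assms s that c[of i q] c[of "i - 1" q] c[of "s i" q] by auto
    finally show ?thesis .
  qed
  have 1: "(\<Sum>k<n. path_ev n k * path_vec n k i * path_vec n k j) = 0"
    unfolding r using assms by (intro t) auto
  have 2: "(\<Sum>k<n. (path_ev n k)\<^sup>2 * path_vec n k i * path_vec n k j) = 0"
  proof -
    have "(\<Sum>k<n. (path_ev n k)\<^sup>2 * path_vec n k i * path_vec n k j)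
        = (\<Sum>k<n. (path_ev n k * path_vec n k i) * (path_ev n k * path_vec n k j))"
      by (simp add: power2_eq_square mult_ac)
    also have "\<dots> = (\<Sum>k<n. r k * (2 * path_vec n k j - path_vec n k (j - 1) - path_vec n k (s j)))"
      unfolding r path_vec_eigen[OF assms(2)] s_def ..
    also have "\<dots> = 2 * (\<Sum>k<n. r k * path_vec n k j) - (\<Sum>k<n. r k * path_vec n k (j - 1))
          - (\<Sum>k<n. r k * path_vec n k (s j))"
      by (simp add: sum_subtractf[symmetric] sum_distrib_left algebra_simps)
    also have "\<dots> = 0"
    proof -
      have "j - 1 < n" "i + 1 < j \<or> j + 1 < i" "i + 1 < j - 1 \<or> (j - 1) + 1 < i"
        "i + 1 < s j \<or> s j + 1 < i"
        using assms s by arith+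
      then show ?thesis using t[of j] t[of "j - 1"] t[of "s j"] assms(2) s(2) by simp
    qed
    finally show ?thesis .
  qed
  have "(\<Sum>k<n. (a * (path_ev n k)\<^sup>2 + b * path_ev n k) * path_vec n k i * path_vec n k j)
      = a * (\<Sum>k<n. (path_ev n k)\<^sup>2 * path_vec n k i * path_vec n k j)
        + b * (\<Sum>k<n. path_ev n k * path_vec n k i * path_vec n k j)"
    unfolding sum_distrib_left sum.distrib[symmetric] by (intro sum.cong) (auto simp: algebra_simps)
  then show ?thesis by (simp add: 1 2)
qed

section \<open>A gossip matrix with prescribed eigengap\<close>

lemma abs_sin_multiple_le: "\<bar>sin (real n * x)\<bar> \<le> real n * \<bar>sin x\<bar>"
proof (induction n)
  case (Suc n)
  have "\<bar>sin (real (Suc n) * x)\<bar> = \<bar>sin (real n * x) * cos x + cos (real n * x) * sin x\<bar>"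
    by (simp add: algebra_simps sin_add)
  also have "\<dots> \<le> \<bar>sin (real n * x)\<bar> * \<bar>cos x\<bar> + \<bar>cos (real n * x)\<bar> * \<bar>sin x\<bar>"
    by (metis abs_mult abs_triangle_ineq)
  also have "\<dots> \<le> \<bar>sin (real n * x)\<bar> * 1 + 1 * \<bar>sin x\<bar>"
    by (intro add_mono mult_left_mono mult_right_mono) auto
  finally show ?case using Suc by (simp add: algebra_simps)
qed simp

text \<open>
  The eigenvalue is \<open>4 (sin x)\<^sup>2\<close> for \<open>x = pi / (2 n)\<close>. The lower bound follows from
  \<open>1 = sin (n x) \<le> n sin x\<close>.
\<close>

lemma path_ev_1_bounds:
  assumes "0 < n"
  shows "4 / (real n)\<^sup>2 \<le> path_ev n 1" "path_ev n 1 \<le> 16 / (real n)\<^sup>2"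
proof -
  define x where "x = pi / (2 * real n)"
  have "path_ev n 1 = 2 - 2 * cos (2 * x)" by (simp add: path_ev_def x_def)
  then have l: "path_ev n 1 = (2 * \<bar>sin x\<bar>)\<^sup>2"
    by (simp add: cos_double_sin power_mult_distrib)
  have "1 \<le> real n * \<bar>sin x\<bar>"
    using abs_sin_multiple_le[of n x] assms by (simp add: x_def)
  then have "2 / real n \<le> 2 * \<bar>sin x\<bar>"
    using assms by (simp add: field_simps)
  then have "(2 / real n)\<^sup>2 \<le> (2 * \<bar>sin x\<bar>)\<^sup>2"
    by (intro power_mono) auto
  then show "4 / (real n)\<^sup>2 \<le> path_ev n 1"
    unfolding l by (simp add: power_divide)
  have "2 * \<bar>sin x\<bar> \<le> 2 * \<bar>x\<bar>" using abs_sin_x_le_abs_x[of x] by simp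
  also have "\<dots> \<le> 4 / real n"
    using pi_less_4 assms by (simp add: x_def field_simps)
  finally have "(2 * \<bar>sin x\<bar>)\<^sup>2 \<le> (4 / real n)\<^sup>2"
    by (intro power_mono) auto
  then show "path_ev n 1 \<le> 16 / (real n)\<^sup>2"
    unfolding l by (simp add: power_divide)
qed

lemma path_ev_last:
  assumes "0 < n"
  shows "path_ev n (n - 1) = 4 - path_ev n 1"
proof -
  have "pi * real (n - 1) / real n = pi - pi * real 1 / real n"
    using assms by (simp add: of_nat_diff field_simps)
  then show ?thesis by (simp add: path_ev_def cos_diff)
qed

text \<open>
  The eigengap of the path depends on \<open>n\<close> alone and takes countably many values. A polynomial
  \<open>p x = a x\<^sup>2 + b x\<close> in the Laplacian adds a continuous parameter: it keeps the eigenvectors, and for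
  the smallest positive eigenvalue \<open>l\<close> and the largest eigenvalue \<open>4 - l\<close> the conditions \<open>p l = \<gamma>\<close> and
  \<open>p (4 - l) = 1\<close> determine \<open>a\<close> and \<open>b\<close>. The other eigenvalues stay between \<open>\<gamma>\<close> and \<open>1\<close> if \<open>p\<close> is
  increasing, for which \<open>a \<ge> 0\<close> and \<open>b \<ge> 0\<close> suffice; this amounts to
  \<open>(l / (4 - l))\<^sup>2 \<le> \<gamma> \<le> l / (4 - l)\<close>. Since \<open>l\<close> is of order \<open>1 / n\<^sup>2\<close>, the choice
  \<open>n = \<lfloor>1 / sqrt \<gamma>\<rfloor>\<close> satisfies both inequalities when \<open>\<gamma>\<close> is small. For larger \<open>\<gamma>\<close> the path on
  three nodes will do, because it has no further eigenvalues.
\<close>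

lemma path_polynomial_exists:
  fixes \<gamma> :: real
  assumes "0 < \<gamma>" "\<gamma> \<le> 1"
  obtains n :: nat and a b :: real and \<mu> :: "nat \<Rightarrow> real"
  where "3 \<le> n" "3 / 8 \<le> real n * sqrt \<gamma>"
    and "\<mu> = (\<lambda>k. a * (path_ev n k)\<^sup>2 + b * path_ev n k)" "\<mu> 1 = \<gamma>" "\<mu> (n - 1) = 1"
    and "\<And>k. 1 \<le> k \<Longrightarrow> k < n \<Longrightarrow> \<gamma> \<le> \<mu> k \<and> \<mu> k \<le> 1"
proof (cases "1 / 64 \<le> \<gamma>")
  case True
  have ev: "path_ev 3 1 = 1" "path_ev 3 2 = 3"
    using path_ev_last[of 3] by (simp_all add: path_ev_def cos_60)
  define a where "a = (1 / 3 - \<gamma>) / 2"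
  define b where "b = \<gamma> - a"
  define \<mu> where "\<mu> = (\<lambda>k. a * (path_ev 3 k)\<^sup>2 + b * path_ev 3 k)"
  have \<mu>: "\<mu> 1 = \<gamma>" "\<mu> 2 = 1"
    unfolding \<mu>_def ev by (simp_all add: a_def b_def field_simps)
  have "1 / 8 \<le> sqrt \<gamma>"
    using True by (intro real_le_rsqrt) (simp add: power_divide)
  moreover have "\<gamma> \<le> \<mu> k \<and> \<mu> k \<le> 1" if "1 \<le> k" "k < 3" for k
  proof -
    have "k = 1 \<or> k = 2" using that by auto
    then show ?thesis using \<mu> assms by auto
  qed
  ultimately show thesis
    using \<mu> by (intro that[of 3 \<mu> a b]) (simp_all add: \<mu>_def)
next
  case False
  define g where "g = sqrt \<gamma>"
  have g: "0 < g" "g\<^sup>2 = \<gamma>" using assms by (auto simp: g_def)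
  have "g\<^sup>2 < (1 / 8)\<^sup>2" using False g by (simp add: power_divide)
  then have g8: "g < 1 / 8" by (rule power_less_imp_less_base) simp
  define n where "n = nat \<lfloor>1 / g\<rfloor>"
  have "8 \<le> 1 / g" using g g8 by (simp add: field_simps)
  then have n: "8 \<le> n" "real n \<le> 1 / g" "1 / g - 1 \<le> real n"
    unfolding n_def by linarith+
  have ng: "real n * g \<le> 1" "7 / 8 \<le> real n * g"
    using n g g8 by (simp_all add: field_simps)
  define l where "l = path_ev n 1"
  have "g \<le> 1 / real n" using ng(1) n(1) by (simp add: field_simps)
  then have "\<gamma> \<le> (1 / real n)\<^sup>2" unfolding g(2)[symmetric] using g by (intro power_mono) auto
  moreover have "4 / (real n)\<^sup>2 = 4 * (1 / real n)\<^sup>2" by (simp add: power_divide)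
  ultimately have l_lower: "4 * \<gamma> \<le> l"
    using path_ev_1_bounds(1)[of n] n(1) by (simp add: l_def)
  have "1 / real n \<le> 8 / 7 * g" using ng(2) n(1) by (simp add: field_simps)
  then have "(1 / real n)\<^sup>2 \<le> (8 / 7 * g)\<^sup>2" using n(1) by (intro power_mono) auto
  then have "(1 / real n)\<^sup>2 \<le> 64 / 49 * \<gamma>" by (simp add: power_mult_distrib g power_divide)
  moreover have "16 / (real n)\<^sup>2 = 16 * (1 / real n)\<^sup>2" by (simp add: power_divide)
  ultimately have l_upper: "l \<le> 21 * \<gamma>"
    using path_ev_1_bounds(2)[of n] n(1) assms by (simp add: l_def)
  have "0 < l" using l_lower assms by linarith
  have "l \<le> 1 / 2" using l_upper False by linarith
  define a where "a = (1 / (4 - l) - \<gamma> / l) / (4 - 2 * l)"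
  define b where "b = \<gamma> / l - a * l"
  have "\<gamma> * (4 - l) \<le> \<gamma> * 4"
    using \<open>0 < l\<close> assms by (intro mult_left_mono) auto
  then have "\<gamma> * (4 - l) \<le> l" using l_lower by linarith
  then have "0 \<le> a"
    unfolding a_def using \<open>0 < l\<close> \<open>l \<le> 1 / 2\<close>
    by (intro divide_nonneg_nonneg) (simp_all add: field_simps)
  have "l * l \<le> (21 * \<gamma>) * (21 * \<gamma>)"
    using l_upper \<open>0 < l\<close> by (intro mult_mono) auto
  also have "\<dots> \<le> \<gamma> * 9"
    using False assms by simp
  also have "\<dots> \<le> \<gamma> * ((4 - l) * (4 - l))"
    using mult_mono[of 3 "4 - l" 3 "4 - l"] \<open>l \<le> 1 / 2\<close> assms by (intro mult_left_mono) auto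
  finally have "l / (4 - l) \<le> \<gamma> * (4 - l) / l"
    using \<open>0 < l\<close> \<open>l \<le> 1 / 2\<close> by (simp add: field_simps)
  moreover have "l * (1 / (4 - l) - \<gamma> / l) = l / (4 - l) - \<gamma>"
    "\<gamma> / l * (4 - 2 * l) = \<gamma> * (4 - l) / l - \<gamma>"
    using \<open>0 < l\<close> by (simp_all add: right_diff_distrib diff_divide_distrib)
  ultimately have "l * (1 / (4 - l) - \<gamma> / l) \<le> \<gamma> / l * (4 - 2 * l)" by linarith
  then have "0 \<le> b"
    unfolding b_def a_def using \<open>l \<le> 1 / 2\<close> by (simp add: pos_divide_le_eq mult.commute)
  define p where "p = (\<lambda>x. a * x\<^sup>2 + b * x)"
  have p_mono: "p x \<le> p y" if "0 \<le> x" "x \<le> y" for x y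
    unfolding p_def using \<open>0 \<le> a\<close> \<open>0 \<le> b\<close> that by (intro add_mono mult_left_mono power_mono) auto
  have p1: "p l = \<gamma>" using \<open>0 < l\<close> by (simp add: p_def b_def power2_eq_square algebra_simps)
  have "p (4 - l) = (4 - l) * (a * (4 - 2 * l) + (b + a * l))"
    by (simp add: p_def power2_eq_square algebra_simps)
  also have "b + a * l = \<gamma> / l" by (simp add: b_def)
  also have "a * (4 - 2 * l) = 1 / (4 - l) - \<gamma> / l"
    using \<open>l \<le> 1 / 2\<close> by (simp add: a_def)
  finally have p2: "p (4 - l) = 1" using \<open>l \<le> 1 / 2\<close> by simp
  have ev_last: "path_ev n (n - 1) = 4 - l"
    using path_ev_last[of n] n(1) by (simp add: l_def)
  have ev_mono: "path_ev n i \<le> path_ev n j" if "i \<le> j" "j < n" for i j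
    using path_ev_strict_mono[of i j n] that by (cases "i = j") auto
  have "\<gamma> \<le> p (path_ev n k) \<and> p (path_ev n k) \<le> 1" if "1 \<le> k" "k < n" for k
  proof -
    have "l \<le> path_ev n k" "path_ev n k \<le> 4 - l"
      using ev_mono[of 1 k] ev_mono[of k "n - 1"] that ev_last by (auto simp: l_def)
    then show ?thesis
      using p_mono[of l "path_ev n k"] p_mono[of "path_ev n k" "4 - l"] p1 p2 \<open>0 < l\<close> by auto
  qed
  then show thesis
    using n(1) ng(2) p1 p2 ev_last l_def
    by (intro that[of n "\<lambda>k. p (path_ev n k)" a b]) (simp_all add: p_def g_def)
qed

definition band_graph :: "nat \<Rightarrow> (nat \<times> nat) set" where
  "band_graph n = {(i, j). i < n \<and> j < n \<and> i \<noteq> j \<and> i \<le> j + 2 \<and> j \<le> i + 2}"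

lemma connected_band_graph: "connected_simple_graph n (band_graph n)"
proof -
  have sym: "sym (band_graph n)" by (auto simp: band_graph_def sym_def)
  have from0: "(0, i) \<in> (band_graph n)\<^sup>*" if "i < n" for i
    using that
  proof (induction i)
    case (Suc i)
    then have "(i, Suc i) \<in> band_graph n" by (simp add: band_graph_def)
    then show ?case using Suc by (meson Suc_lessD rtrancl.rtrancl_into_rtrancl)
  qed simp
  have "(i, j) \<in> (band_graph n)\<^sup>*" if "i < n" "j < n" for i j
    using from0[OF that(1)] from0[OF that(2)] sym_rtrancl[OF sym]
    by (meson rtrancl_trans symD)
  then show ?thesis
    using sym by (auto simp: connected_simple_graph_def band_graph_def irrefl_def)
qed

lemma gossip_matrix_with_eigengap:
  fixes \<gamma> :: real
  assumes "0 < \<gamma>" "\<gamma> \<le> 1"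
  obtains n :: nat and W :: "real mat"
  where "3 \<le> n" "3 / 8 \<le> real n * sqrt \<gamma>" "gossip_matrix n (band_graph n) W" "eigengap W = \<gamma>"
proof -
  obtain n a b \<mu> where n: "3 \<le> n" "3 / 8 \<le> real n * sqrt \<gamma>"
    and \<mu>: "\<mu> = (\<lambda>k. a * (path_ev n k)\<^sup>2 + b * path_ev n k)" "\<mu> 1 = \<gamma>" "\<mu> (n - 1) = 1"
    and between: "\<And>k. 1 \<le> k \<Longrightarrow> k < n \<Longrightarrow> \<gamma> \<le> \<mu> k \<and> \<mu> k \<le> 1"
    by (rule path_polynomial_exists[OF assms]) blast
  interpret orthonormal_system n "path_vec n" by (rule orthonormal_system_path_vec)
  have \<mu>0: "\<mu> 0 = 0" by (simp add: \<mu>(1) path_ev_0)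
  have "gossip_matrix n (band_graph n) (spectral_mat \<mu>)"
  proof (rule gossip_matrix_spectral_mat[where c = "path_vec n 0 0"])
    show "path_vec n 0 i = path_vec n 0 0" for i by (simp add: path_vec_def path_cos_def)
    show "0 < \<mu> k" if "1 \<le> k" "k < n" for k using between[OF that] assms by linarith
    show "(\<Sum>k<n. \<mu> k * path_vec n k i * path_vec n k j) = 0"
      if "i < n" "j < n" "i \<noteq> j" "(i, j) \<notin> band_graph n" for i j
      unfolding \<mu>(1) using that by (intro path_polynomial_local) (auto simp: band_graph_def)
  qed (use n \<mu>0 in auto)
  moreover have "eigengap (spectral_mat \<mu>) = \<gamma>"
    using eigengap_spectral_mat[of \<mu>] n \<mu>0 \<mu>(2,3) between assms by simp
  ultimately show thesis using n that by blast
qed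

section \<open>The lower bound\<close>

text \<open>
  The root below \<open>1\<close> of \<open>(1 - q)\<^sup>2 = 2 r q\<close>. With \<open>r\<close> of order \<open>1 / \<kappa>\<close> the last bound shows
  that \<open>ln (1 / q)\<close> is at most of order \<open>1 / sqrt \<kappa>\<close>.
\<close>

lemma decay_rate_exists:
  fixes r :: real
  assumes "0 < r"
  obtains q where "0 < q" "q < 1" "(1 - q)\<^sup>2 = 2 * r * q" "(ln (1 / q))\<^sup>2 \<le> 4 * r * (1 + r)"
proof -
  define w where "w = sqrt (r\<^sup>2 + 2 * r)"
  have w2: "w\<^sup>2 = r\<^sup>2 + 2 * r" using assms by (simp add: w_def)
  have "r < w" unfolding w_def using assms by (intro real_less_rsqrt) auto
  have "w < 1 + r" unfolding w_def using assms
    by (intro real_less_lsqrt) (auto simp: power2_eq_square algebra_simps)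
  define q where "q = 1 + r - w"
  have q: "0 < q" "q < 1" using \<open>r < w\<close> \<open>w < 1 + r\<close> by (auto simp: q_def)
  have "(1 - q)\<^sup>2 = w\<^sup>2 - 2 * w * r + r\<^sup>2" by (simp add: q_def power2_eq_square algebra_simps)
  also have "\<dots> = 2 * r * q" unfolding w2 by (simp add: q_def power2_eq_square algebra_simps)
  finally have eq: "(1 - q)\<^sup>2 = 2 * r * q" .
  have "1 / q = 1 + r + w"
  proof -
    have "q * (1 + r + w) = (1 + r)\<^sup>2 - w\<^sup>2"
      by (simp add: q_def power2_eq_square algebra_simps)
    then have "q * (1 + r + w) = 1" unfolding w2 by (simp add: power2_eq_square algebra_simps)
    then show ?thesis using q by (simp add: field_simps)
  qed
  then have "1 / q \<le> 2 * (1 + r)" using \<open>w < 1 + r\<close> by simp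
  have "ln (1 / q) \<le> 1 / q - 1" using q by (intro ln_le_minus_one) auto
  moreover have "0 \<le> ln (1 / q)" using q by simp
  ultimately have "(ln (1 / q))\<^sup>2 \<le> (1 / q - 1)\<^sup>2" by (intro power_mono) auto
  also have "\<dots> = (1 - q)\<^sup>2 / q\<^sup>2"
    using q by (simp add: field_simps power2_eq_square)
  also have "\<dots> = 2 * r * (1 / q)"
    unfolding eq using q by (simp add: power2_eq_square)
  also have "\<dots> \<le> 2 * r * (2 * (1 + r))"
    using \<open>1 / q \<le> 2 * (1 + r)\<close> assms by (intro mult_left_mono) auto
  finally show thesis using that[OF q eq] by (simp add: mult_ac)
qed

text \<open>
  For odd \<open>k\<close> only the first \<open>m\<close> nodes can leave \<open>prefix_space k\<close>, for even \<open>k\<close> only the last \<open>m\<close>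
  nodes. An edge of the band graph bridges a difference of at most two in the numbering of the
  nodes, so the two groups are at least \<open>d\<close> communications apart.
\<close>

lemma black_box_output_in_prefix_space:
  fixes \<alpha> \<beta> c \<tau> :: real
  assumes run: "black_box_procedure n W \<tau> f M out"
    and f: "f = (\<lambda>i. projected_quadratic (antisym_part (node_swap n m i)) \<alpha> \<beta> (c *\<^sub>R first_unit))"
    and "gossip_matrix n (band_graph n) W" "0 < \<tau>" "0 < \<alpha>" "\<alpha> \<le> \<beta>" "2 * m \<le> n"
    and d: "d = (real n - 2 * real m + 1) / 2"
    and "1 \<le> k" "i < n" "0 \<le> t" "t < (real k - 1) * (1 + d * \<tau>)"
  shows "out i t \<in> prefix_space k"
proof (rule ccontr)
  assume out: "out i t \<notin> prefix_space k"
  \<comment> \<open>Half the distance in the numbering to the nodes that can leave \<open>prefix_space k\<close>. The values for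
    the two parities always add up to \<open>d\<close>, so \<open>h\<close> vanishes for one parity only where it is at least
    \<open>d\<close> for the other.\<close>
  define g :: "nat \<Rightarrow> nat \<Rightarrow> real" where
    "g k i = (if odd k then (real i - (real m - 1)) / 2 else (real n - real m - real i) / 2)" for k i
  define h where "h k i = max 0 (g k i)" for k i
  have "(real k - 1) * (1 + d * \<tau>) + \<tau> * h k i \<le> t"
  proof (rule black_box_time_to_leave[where V = prefix_space and n = n and W = W and f = f])
    show "black_box_procedure n W \<tau> f M out" "0 < \<tau>" by fact+
    show "W \<in> carrier_mat n n" using assms by (simp add: gossip_matrix_def)
    show "Real_Vector_Spaces.subspace (prefix_space k)" for k by (rule subspace_prefix_space)
    show "grad (f i) \<theta> \<in> prefix_space (Suc k) \<and> grad (fenchel_conjugate (f i)) \<theta> \<in> prefix_space (Suc k)"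
      if "1 \<le> k" "i < n" "\<theta> \<in> prefix_space k" for k i \<theta>
      using that projected_quadratic_grads_in_prefix_space[OF fun_cong[OF f, of i] \<open>0 < \<alpha>\<close> \<open>\<alpha> \<le> \<beta>\<close>
          node_swap_involution node_swap_ge] by auto
    show "grad (f i) \<theta> \<in> prefix_space k \<and> grad (fenchel_conjugate (f i)) \<theta> \<in> prefix_space k"
      if k: "1 \<le> k" "i < n" "0 < h k i" "\<theta> \<in> prefix_space k" for k i \<theta>
    proof -
      have g: "0 < g k i" using k(3) by (simp add: h_def less_max_iff_disj)
      have "k \<le> node_swap n m i j" if "k \<le> j" for j
      proof (cases "odd k")
        case True
        then have "m \<le> i" using g by (simp add: g_def)
        then show ?thesis using odd_swap_ge[OF True that] that by (simp add: node_swap_def)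
      next
        case False
        then have "i < n - m" using g by (simp add: g_def)
        then show ?thesis using even_swap_ge[of k j] False that by (simp add: node_swap_def)
      qed
      then show ?thesis
        using k projected_quadratic_grads_in_prefix_space[OF fun_cong[OF f, of i] \<open>0 < \<alpha>\<close> \<open>\<alpha> \<le> \<beta>\<close>
            node_swap_involution, of k k \<theta>] by auto
    qed
    show "h k i \<le> h k j + 1" if "i < n" "j < n" "W $$ (i, j) \<noteq> 0" for k i j
    proof -
      have "i = j \<or> (i, j) \<in> band_graph n"
        using assms that by (auto simp: gossip_matrix_def)
      then have "i \<le> j + 2" "j \<le> i + 2" by (auto simp: band_graph_def)
      then have "real i \<le> real j + 2" "real j \<le> real i + 2" by linarith+
      then have "g k i \<le> g k j + 1" by (simp add: g_def field_simps)
      then show ?thesis by (simp add: h_def max_def)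
    qed
    show "d \<le> h k i" if "h (Suc k) i \<le> 0" for k i
    proof -
      have "g (Suc k) i + g k i = d" by (simp add: g_def d field_simps)
      then show ?thesis using that by (simp add: h_def)
    qed
    show "1 \<le> k" "i < n" "out i t \<notin> prefix_space k" by fact+
    show "out i t \<in> M i t"
      using run \<open>i < n\<close> \<open>0 \<le> t\<close> by (simp add: black_box_procedure_def)
  qed
  moreover have "0 \<le> \<tau> * h k i" using \<open>0 < \<tau>\<close> by (simp add: h_def)
  ultimately show False using assms by linarith
qed

text \<open>
  A vector supported on the first \<open>k\<close> coordinates misses the coordinate \<open>q ^ k\<close> of the minimiser.
\<close>

lemma hard_instance_precision:
  fixes \<alpha> \<beta> q :: real
  assumes "c = \<alpha> + (\<beta> - \<alpha>) * (real m / real n) * (1 - q) / 2"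
    and "2 * m \<le> n" "0 < n" "0 \<le> \<alpha>" "\<alpha> \<le> \<beta>" "0 < q" "q < 1"
    and "(\<beta> - \<alpha>) * (real m / real n) * (1 - q)\<^sup>2 = 2 * \<alpha> * q"
    and "f = (\<lambda>i. projected_quadratic (antisym_part (node_swap n m i)) \<alpha> \<beta> (c *\<^sub>R first_unit))"
    and x: "x \<in> prefix_space k"
  shows "\<alpha> / 2 * q ^ (2 * k) \<le> avg_fun n f x - avg_fun n f (arg_min (avg_fun n f) (\<lambda>_. True))"
proof -
  define z where "z = geometric q"
  have excess: "avg_fun n f z + \<alpha> / 2 * (norm (y - z))\<^sup>2 \<le> avg_fun n f y" for y
    unfolding z_def using assms by (intro avg_fun_growth)
  have "avg_fun n f z \<le> avg_fun n f y" for y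
  proof -
    have "0 \<le> \<alpha> / 2 * (norm (y - z))\<^sup>2" using \<open>0 \<le> \<alpha>\<close> by simp
    then show ?thesis using excess[of y] by linarith
  qed
  then have "avg_fun n f (arg_min (avg_fun n f) (\<lambda>_. True)) \<le> avg_fun n f z"
    by (rule avg_fun_arg_min_le)
  moreover have "\<alpha> / 2 * q ^ (2 * k) \<le> \<alpha> / 2 * (norm (x - z))\<^sup>2"
  proof (intro mult_left_mono)
    have "ell2_nth (x - z) k = - (q ^ k)"
      using x \<open>0 < q\<close> \<open>q < 1\<close> by (simp add: prefix_space_def ell2_nth_diff z_def ell2_nth_geometric)
    then show "q ^ (2 * k) \<le> (norm (x - z))\<^sup>2"
      using ell2_nth_square_le_norm[of "x - z" k] by (simp add: power_mult mult.commute)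
  qed (use \<open>0 \<le> \<alpha>\<close> in simp)
  ultimately show ?thesis using excess[of x] by linarith
qed

text \<open>
  Here \<open>s\<close> is the time needed per coordinate and \<open>k\<close> the number of coordinates that may have been
  reached at time \<open>t\<close>, up to rounding; the inequality \<open>\<alpha> / 2 * q ^ (2 * k) \<le> \<epsilon>\<close> is solved for \<open>t\<close>.
\<close>

lemma time_bound_arithmetic:
  fixes t s q \<alpha> \<epsilon> :: real
  assumes "0 < s" "0 \<le> t" "0 < q" "q < 1" "0 < \<alpha>"
    and k: "k = nat \<lfloor>t / s\<rfloor> + 2" and le: "\<alpha> / 2 * q ^ (2 * k) \<le> \<epsilon>"
  shows "s / (2 * ln (1 / q)) * (ln (1 / \<epsilon>) - ln (2 / \<alpha>)) - 2 * s \<le> t"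
proof -
  define L where "L = ln (1 / q)"
  have "0 < L" using assms by (simp add: L_def)
  have "0 < \<alpha> / 2 * q ^ (2 * k)" using assms by simp
  with le have "ln (\<alpha> / 2 * q ^ (2 * k)) \<le> ln \<epsilon>" by (subst ln_le_cancel_iff) auto
  moreover have "ln (\<alpha> / 2 * q ^ (2 * k)) = - ln (2 / \<alpha>) - 2 * real k * L"
    using \<open>0 < \<alpha>\<close> \<open>0 < q\<close> by (simp add: L_def ln_mult ln_div ln_realpow)
  moreover have "ln (1 / \<epsilon>) = - ln \<epsilon>"
    using le \<open>0 < \<alpha> / 2 * q ^ (2 * k)\<close> by (simp add: ln_div)
  ultimately have "ln (1 / \<epsilon>) - ln (2 / \<alpha>) \<le> 2 * L * real k" by (simp add: algebra_simps)
  also have "\<dots> \<le> 2 * L * (t / s + 2)"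
    using \<open>0 < L\<close> assms(1,2) by (intro mult_left_mono) (auto simp: k)
  finally have "s / (2 * L) * (ln (1 / \<epsilon>) - ln (2 / \<alpha>)) \<le> s / (2 * L) * (2 * L * (t / s + 2))"
    using \<open>0 < s\<close> \<open>0 < L\<close> by (intro mult_left_mono) auto
  also have "\<dots> = t + 2 * s" using \<open>0 < s\<close> \<open>0 < L\<close> by (simp add: field_simps)
  finally show ?thesis by (simp add: L_def)
qed

text \<open>
  With a third of the nodes in each group, the number \<open>r\<close> that determines \<open>q\<close> is of order \<open>1 / \<kappa>\<close>.
  This is where \<open>\<kappa>\<close> has to stay away from \<open>1\<close>.
\<close>

lemma decay_ratio_le:
  fixes \<kappa>\<^sub>0 \<kappa> :: real
  assumes "1 < \<kappa>\<^sub>0" "\<kappa>\<^sub>0 \<le> \<kappa>" "3 \<le> n"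
  defines "r \<equiv> real n / (real (n div 3) * (\<kappa> - 1))"
  shows "0 < r" "r \<le> 5 * \<kappa>\<^sub>0 / (\<kappa>\<^sub>0 - 1) / \<kappa>"
proof -
  have "1 \<le> n div 3" "n \<le> 5 * (n div 3)" using assms(3) by presburger+
  then have m: "0 < real (n div 3)" "real n \<le> 5 * real (n div 3)" by linarith+
  show "0 < r" using assms m by (simp add: r_def)
  have "r = real n / real (n div 3) * (1 / (\<kappa> - 1))" by (simp add: r_def)
  also have "\<dots> \<le> 5 * (\<kappa>\<^sub>0 / (\<kappa>\<^sub>0 - 1) / \<kappa>)"
  proof (intro mult_mono)
    show "real n / real (n div 3) \<le> 5" using m by (simp add: field_simps)
    show "1 / (\<kappa> - 1) \<le> \<kappa>\<^sub>0 / (\<kappa>\<^sub>0 - 1) / \<kappa>"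
      using assms by (simp add: field_simps)
  qed (use assms in auto)
  finally show "r \<le> 5 * \<kappa>\<^sub>0 / (\<kappa>\<^sub>0 - 1) / \<kappa>" by simp
qed

theorem corollary2:
  fixes \<kappa>\<^sub>0 :: real
  assumes "\<kappa>\<^sub>0 > 1"
  shows "\<exists>C>0. \<forall>\<alpha> \<beta> \<kappa>\<^sub>l \<gamma> :: real.
    \<alpha> > 0 \<longrightarrow> \<beta> > 0 \<longrightarrow> \<kappa>\<^sub>l = \<beta> / \<alpha> \<longrightarrow> \<kappa>\<^sub>l \<ge> \<kappa>\<^sub>0 \<longrightarrow> 0 < \<gamma> \<longrightarrow> \<gamma> \<le> 1 \<longrightarrow>
    (\<exists>(n :: nat) (E :: (nat \<times> nat) set) (W :: real mat) (f :: nat \<Rightarrow> ell2 \<Rightarrow> real).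
       n \<ge> 2 \<and> connected_simple_graph n E \<and> gossip_matrix n E W \<and> eigengap W = \<gamma> \<and>
       (\<forall>i<n. strongly_convex \<alpha> (f i) \<and> smooth \<beta> (f i)) \<and>
       (\<forall>\<tau>>0. \<exists>D. \<forall>M out. black_box_procedure n W \<tau> f M out \<longrightarrow>
          (\<forall>\<epsilon>>0. time_to_precision n f out \<epsilon> \<ge>
             ereal (C * (sqrt \<kappa>\<^sub>l * (1 + \<tau> / sqrt \<gamma>) * ln (1 / \<epsilon>)) - D))))"
proof -
  define R where "R = 5 * \<kappa>\<^sub>0 / (\<kappa>\<^sub>0 - 1)"
  define K where "K = sqrt (4 * R * (1 + R))"
  have "0 < R" using assms by (simp add: R_def)
  then have "0 < K" by (simp add: K_def)
  show ?thesis
  proof (intro exI[of _ "1 / (32 * K)"] conjI allI impI)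
    show "0 < 1 / (32 * K)" using \<open>0 < K\<close> by simp
    fix \<alpha> \<beta> \<kappa> \<gamma> :: real
    assume "0 < \<alpha>" "0 < \<beta>" and \<kappa>: "\<kappa> = \<beta> / \<alpha>" "\<kappa>\<^sub>0 \<le> \<kappa>" and \<gamma>: "0 < \<gamma>" "\<gamma> \<le> 1"
    have "1 < \<kappa>" using assms \<kappa> by simp
    then have "\<alpha> < \<beta>" using \<kappa>(1) \<open>0 < \<alpha>\<close> by (simp add: field_simps)
    obtain n W where n: "3 \<le> n" "3 / 8 \<le> real n * sqrt \<gamma>"
      and W: "gossip_matrix n (band_graph n) W" "eigengap W = \<gamma>"
      using gossip_matrix_with_eigengap[OF \<gamma>] by blast
    define m where "m = n div 3"
    have m: "1 \<le> m" "2 * m \<le> n" "3 * m \<le> n" using n by (auto simp: m_def)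
    define d where "d = (real n - 2 * real m + 1) / 2"
    have "real n \<le> 6 * d" using m by (simp add: d_def)
    have "1 / sqrt \<gamma> \<le> 16 * d"
    proof -
      have "3 / 8 / sqrt \<gamma> \<le> real n" using n(2) \<gamma> by (simp add: field_simps)
      then show ?thesis using \<open>real n \<le> 6 * d\<close> by simp
    qed
    define r where "r = real n / (real m * (\<kappa> - 1))"
    have r: "0 < r" "r \<le> R / \<kappa>"
      using decay_ratio_le[OF assms \<kappa>(2) n(1)] by (simp_all add: r_def m_def R_def)
    obtain q where q: "0 < q" "q < 1" "(1 - q)\<^sup>2 = 2 * r * q" "(ln (1 / q))\<^sup>2 \<le> 4 * r * (1 + r)"
      using decay_rate_exists[OF r(1)] by blast
    define L where "L = ln (1 / q)"
    have "0 < L" using q by (simp add: L_def)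
    have "L \<le> K / sqrt \<kappa>"
    proof -
      have "R / \<kappa> \<le> R" using \<open>0 < R\<close> \<open>1 < \<kappa>\<close> by (simp add: field_simps)
      then have "4 * r * (1 + r) \<le> 4 * (R / \<kappa>) * (1 + R)"
        using r by (intro mult_mono) auto
      then have "L\<^sup>2 \<le> (K / sqrt \<kappa>)\<^sup>2"
        using q(4) \<open>0 < R\<close> \<open>1 < \<kappa>\<close> by (simp add: L_def K_def power_divide)
      then show ?thesis using \<open>0 < K\<close> \<open>1 < \<kappa>\<close> by (elim power2_le_imp_le) simp
    qed
    then have "L * sqrt \<kappa> \<le> K" using \<open>1 < \<kappa>\<close> by (simp add: field_simps)
    then have rate: "sqrt \<kappa> / K \<le> 1 / L" using \<open>0 < L\<close> \<open>0 < K\<close> by (simp add: field_simps)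
    have balance: "(\<beta> - \<alpha>) * (real m / real n) * (1 - q)\<^sup>2 = 2 * \<alpha> * q"
    proof -
      have "(\<beta> - \<alpha>) * (real m / real n) * r = \<alpha>"
        using \<open>0 < \<alpha>\<close> \<open>1 < \<kappa>\<close> m n by (simp add: r_def \<kappa>(1) field_simps)
      then have "(\<beta> - \<alpha>) * (real m / real n) * r * (2 * q) = \<alpha> * (2 * q)" by (simp only:)
      then show ?thesis unfolding q(3) by (simp only: mult_ac)
    qed
    define c where "c = \<alpha> + (\<beta> - \<alpha>) * (real m / real n) * (1 - q) / 2"
    define f where
      "f = (\<lambda>i. projected_quadratic (antisym_part (node_swap n m i)) \<alpha> \<beta> (c *\<^sub>R first_unit))"
    have "strongly_convex \<alpha> (f i) \<and> smooth \<beta> (f i)" for i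
    proof -
      interpret orthogonal_projection "antisym_part (node_swap n m i)"
        by (rule orthogonal_projection_antisym_part) (rule node_swap_involution)
      show ?thesis
        using strongly_convex_quadratic smooth_quadratic \<open>0 < \<alpha>\<close> \<open>\<alpha> < \<beta>\<close> by (simp add: f_def)
    qed
    moreover have "\<exists>D. \<forall>M out. black_box_procedure n W \<tau> f M out \<longrightarrow>
        (\<forall>\<epsilon>>0. time_to_precision n f out \<epsilon> \<ge>
           ereal (1 / (32 * K) * (sqrt \<kappa> * (1 + \<tau> / sqrt \<gamma>) * ln (1 / \<epsilon>)) - D))"
      if "0 < \<tau>" for \<tau>
    proof -
      define s where "s = 1 + d * \<tau>"
      have "0 < d" using \<open>real n \<le> 6 * d\<close> n by simp
      then have "0 < s" using \<open>0 < \<tau>\<close> by (simp add: s_def add_pos_pos)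
      define D where "D = \<bar>s / (2 * L) * ln (2 / \<alpha>) + 2 * s\<bar>"
      have "\<tau> / sqrt \<gamma> \<le> 16 * (d * \<tau>)"
        using mult_left_mono[OF \<open>1 / sqrt \<gamma> \<le> 16 * d\<close>, of \<tau>] \<open>0 < \<tau>\<close> by (simp add: mult_ac)
      then have "1 + \<tau> / sqrt \<gamma> \<le> 16 * s" by (simp add: s_def)
      then have mono: "sqrt \<kappa> / K * (1 + \<tau> / sqrt \<gamma>) \<le> 1 / L * (16 * s)"
        using rate \<open>0 < L\<close> \<open>0 < \<tau>\<close> \<gamma> by (intro mult_mono) auto
      have "1 / (32 * K) * (sqrt \<kappa> * (1 + \<tau> / sqrt \<gamma>))
          = sqrt \<kappa> / K * (1 + \<tau> / sqrt \<gamma>) / 32"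
        by simp
      also have "\<dots> \<le> 1 / L * (16 * s) / 32"
        using mono by (rule divide_right_mono) simp
      also have "\<dots> = s / (2 * L)" by simp
      finally have slope: "1 / (32 * K) * (sqrt \<kappa> * (1 + \<tau> / sqrt \<gamma>)) \<le> s / (2 * L)" .
      have "ereal (1 / (32 * K) * (sqrt \<kappa> * (1 + \<tau> / sqrt \<gamma>) * ln (1 / \<epsilon>)) - D)
          \<le> time_to_precision n f out \<epsilon>"
        if run: "black_box_procedure n W \<tau> f M out" and "0 < \<epsilon>" for M out \<epsilon>
        unfolding time_to_precision_def
      proof (rule Inf_greatest, clarify)
        fix t :: real
        assume "0 \<le> t" and reached: "\<forall>i<n. avg_fun n f (out i t)
          - avg_fun n f (arg_min (avg_fun n f) (\<lambda>_. True)) \<le> \<epsilon>"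
        define k where "k = nat \<lfloor>t / s\<rfloor> + 2"
        have "t / s < real k - 1" using \<open>0 \<le> t\<close> \<open>0 < s\<close> unfolding k_def by simp linarith
        then have "t < (real k - 1) * (1 + d * \<tau>)"
          using \<open>0 < s\<close> by (simp add: pos_divide_less_eq s_def)
        then have "out 0 t \<in> prefix_space k"
          using \<open>0 < \<alpha>\<close> \<open>\<alpha> < \<beta>\<close> \<open>0 < \<tau>\<close> \<open>0 \<le> t\<close> m(2) n(1)
          by (intro black_box_output_in_prefix_space[OF run f_def W(1) _ _ _ _ d_def])
             (auto simp: k_def)
        then have "\<alpha> / 2 * q ^ (2 * k)
            \<le> avg_fun n f (out 0 t) - avg_fun n f (arg_min (avg_fun n f) (\<lambda>_. True))"
          using \<open>0 < \<alpha>\<close> \<open>\<alpha> < \<beta>\<close> m(2) n(1) q(1,2)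
          by (intro hard_instance_precision[OF c_def _ _ _ _ _ _ balance f_def]) auto
        also have "\<dots> \<le> \<epsilon>" using reached n(1) by auto
        finally have "s / (2 * L) * (ln (1 / \<epsilon>) - ln (2 / \<alpha>)) - 2 * s \<le> t"
          unfolding L_def
          using \<open>0 < s\<close> \<open>0 \<le> t\<close> q(1,2) \<open>0 < \<alpha>\<close> by (intro time_bound_arithmetic[OF _ _ _ _ _ k_def])
        then have t: "s / (2 * L) * ln (1 / \<epsilon>) - D \<le> t"
          by (simp add: D_def right_diff_distrib)
        show "ereal (1 / (32 * K) * (sqrt \<kappa> * (1 + \<tau> / sqrt \<gamma>) * ln (1 / \<epsilon>)) - D) \<le> ereal t"
        proof (cases "0 \<le> ln (1 / \<epsilon>)")
          case True
          then have "1 / (32 * K) * (sqrt \<kappa> * (1 + \<tau> / sqrt \<gamma>)) * ln (1 / \<epsilon>) \<le> s / (2 * L) * ln (1 / \<epsilon>)"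
            using slope by (intro mult_right_mono)
          then show ?thesis using t by (simp add: mult.assoc)
        next
          \<comment> \<open>For a precision above \<open>1\<close> the bound is negative, since \<open>D \<ge> 0\<close>.\<close>
          case False
          have "0 \<le> 1 / (32 * K) * (sqrt \<kappa> * (1 + \<tau> / sqrt \<gamma>))"
            using \<open>0 < K\<close> \<open>1 < \<kappa>\<close> \<open>0 < \<tau>\<close> \<gamma> by simp
          then have "1 / (32 * K) * (sqrt \<kappa> * (1 + \<tau> / sqrt \<gamma>)) * ln (1 / \<epsilon>) \<le> 0"
            using False by (intro mult_nonneg_nonpos) auto
          moreover have "0 \<le> D" by (simp add: D_def)
          ultimately show ?thesis using \<open>0 \<le> t\<close> by (simp add: mult.assoc)
        qed
      qed
      then show ?thesis by blast
    qed
    ultimately show "\<exists>(n :: nat) (E :: (nat \<times> nat) set) (W :: real mat) (f :: nat \<Rightarrow> ell2 \<Rightarrow> real).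
       n \<ge> 2 \<and> connected_simple_graph n E \<and> gossip_matrix n E W \<and> eigengap W = \<gamma> \<and>
       (\<forall>i<n. strongly_convex \<alpha> (f i) \<and> smooth \<beta> (f i)) \<and>
       (\<forall>\<tau>>0. \<exists>D. \<forall>M out. black_box_procedure n W \<tau> f M out \<longrightarrow>
          (\<forall>\<epsilon>>0. time_to_precision n f out \<epsilon> \<ge>
             ereal (1 / (32 * K) * (sqrt \<kappa> * (1 + \<tau> / sqrt \<gamma>) * ln (1 / \<epsilon>)) - D)))"
      using n(1) W connected_band_graph[of n]
      by (intro exI[of _ n] exI[of _ "band_graph n"] exI[of _ W] exI[of _ f]) auto
  qed
qed

end
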